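(* Suppose that the following holds for every integer $k\ge 2$, every function $g:\mathcal S_k\to\mathbb R$ and all nonnegative reals $\gamma_1,\ldots,\gamma_{k-1}$: $$\sum_{\sigma\in \mathcal S_k} \sum_{i=1}^{k-1} \gamma_{i} [g(\sigma) - g((ik)\sigma)]^2\ge \sum_{\sigma\in \mathcal S_k} \sum_{1\le i<j\le k-1} \frac{\gamma_{i}\gamma_{j}}{\gamma_{1}+\cdots+\gamma_{k-1}} [g(\sigma) - g((ij)\sigma)]^2 .$$ Then for every $n\ge 2$ and all nonnegative edge weights $\alpha=\{\alpha_{ij}\}_{1\le i<j\le n}$ on the vertex set $\{1,\ldots,n\}$, the second smallest eigenvalue of the interchange Laplacian $\mathcal L_n^I(\alpha)$ equals the second smallest eigenvalue of the random-walk Laplacian $\mathcal L_n^{RW}(\alpha)$ (Aldous' conjecture).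
   Context: $\mathcal S_k$ is the symmetric group on $\{1,\ldots,k\}$; $(ij)$ is the transposition of $i$ and $j$; permutations are multiplied from right to left ($\sigma'\sigma$ means first $\sigma$, then $\sigma'$). An empty sum is zero, and if $\gamma_1=\cdots=\gamma_{k-1}=0$ the fractions $\gamma_i\gamma_j/(\gamma_1+\cdots+\gamma_{k-1})$ are read as $0$. For symmetric weights $\alpha_{ij}=\alpha_{ji}\ge 0$ ($i\neq j$ in $\{1,\ldots,n\}$), the random-walk Laplacian $\mathcal L_n^{RW}(\alpha)$ is the $n\times n$ matrix with $(i,j)$ entry $-\alpha_{ij}$ for $i\ne j$ and $(j,j)$ entry $\sum_{k\neq j}\alpha_{kj}$. The interchange Laplacian $\mathcal L_n^I(\alpha)$ is the $n!\times n!$ matrix indexed by $\mathcal S_n$ with entry $(\sigma,\sigma')$ equal to $-\alpha_{ij}$ if $\sigma'=(ij)\sigma$ for some $i<j$, equal to $\sum_{1\le \ell<m\le n}\alpha_{\ell m}$ if $\sigma=\sigma'$, and $0$ otherwise. Both are symmetric positive semidefinite (they are the negatives of the intensity matrices of the random-walk process and the interchange process). "Second smallest eigenvalue" counts eigenvalues with multiplicity. When the graph of positive-weight edges is connected, these second smallest eigenvalues are the spectral gaps of the two processes. *)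

theory Defs
  imports
    "HOL-Combinatorics.Permutations"
    "Jordan_Normal_Form.Char_Poly"
begin

definition Sym :: "nat \<Rightarrow> (nat \<Rightarrow> nat) set" where
  "Sym k = {\<sigma>. \<sigma> permutes {1..k}}"

abbreviation swap :: "nat \<Rightarrow> nat \<Rightarrow> nat \<Rightarrow> nat" where
  "swap i j \<equiv> Transposition.transpose i j"

text \<open>
  The matrix indexed by the entries of a list: library matrices are indexed by
  \<open>{0..<m} \<times> {0..<m}\<close>, so a matrix indexed by a finite set is obtained from a
  duplicate-free enumeration of that set. Another enumeration gives the same matrix up to
  simultaneous permutation of rows and columns.
\<close>

definition indexed_mat :: "'i list \<Rightarrow> ('i \<Rightarrow> 'i \<Rightarrow> real) \<Rightarrow> real mat" where
  "indexed_mat xs f = mat (length xs) (length xs) (\<lambda>(a, b). f (xs ! a) (xs ! b))"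

definition Sym_list :: "nat \<Rightarrow> (nat \<Rightarrow> nat) list" where
  "Sym_list n = (SOME xs. distinct xs \<and> set xs = Sym n)"

lemma finite_Sym: "finite (Sym n)"
  by (simp add: Sym_def finite_permutations)

lemma distinct_Sym_list: "distinct (Sym_list n)"
  and set_Sym_list: "set (Sym_list n) = Sym n"
proof -
  have "\<exists>xs. distinct xs \<and> set xs = Sym n"
    using finite_distinct_list[OF finite_Sym] by blast
  from someI_ex[OF this] show "distinct (Sym_list n)" "set (Sym_list n) = Sym n"
    by (simp_all add: Sym_list_def)
qed

lemma length_Sym_list: "length (Sym_list n) = fact n"
proof -
  have "length (Sym_list n) = card (Sym n)"
    using distinct_card[OF distinct_Sym_list, of n] by (simp add: set_Sym_list)
  then show ?thesis by (simp add: Sym_def card_permutations)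
qed

definition rw_laplacian :: "nat \<Rightarrow> (nat \<Rightarrow> nat \<Rightarrow> real) \<Rightarrow> real mat" where
  "rw_laplacian n \<alpha> =
    indexed_mat [1..<Suc n]
      (\<lambda>i j. if i = j then (\<Sum>k\<in>{1..n} - {j}. \<alpha> k j) else - \<alpha> i j)"

text \<open>
  For \<open>\<sigma> \<noteq> \<sigma>'\<close> there is at most one pair \<open>i < j\<close> with
  \<open>\<sigma>' = swap i j \<circ> \<sigma>\<close>, so the sum in the off-diagonal entry is \<open>\<alpha> i j\<close>
  for that pair, and \<open>0\<close> if there is none.
\<close>

definition interchange_laplacian :: "nat \<Rightarrow> (nat \<Rightarrow> nat \<Rightarrow> real) \<Rightarrow> real mat" where
  "interchange_laplacian n \<alpha> =
    indexed_mat (Sym_list n)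
      (\<lambda>\<sigma> \<sigma>'.
        if \<sigma> = \<sigma>' then (\<Sum>m\<in>{1..n}. \<Sum>l\<in>{1..<m}. \<alpha> l m)
        else - (\<Sum>j\<in>{1..n}. \<Sum>i\<in>{1..<j}. if \<sigma>' = swap i j \<circ> \<sigma> then \<alpha> i j else 0))"

text \<open>
  The real roots of the characteristic polynomial with multiplicity, in increasing order. It is
  only used for symmetric real matrices, whose characteristic polynomial splits over the reals, so
  that the list contains all eigenvalues and has as many entries as the matrix has rows.
\<close>

definition eigenvalue_list :: "real mat \<Rightarrow> real list" where
  "eigenvalue_list A = sorted_list_of_multiset (proots (char_poly A))"

definition second_smallest_eigenvalue :: "real mat \<Rightarrow> real" where
  "second_smallest_eigenvalue A = eigenvalue_list A ! 1"

end

(*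
  The random walk is a projection of the interchange process, which gives one inequality. For the
  other one, induct on n: let f be a mean-zero eigenfunction of the interchange process for its
  second eigenvalue. If the marginal of f at some particle does not vanish, it is an eigenfunction
  of the random walk for the same eigenvalue. Otherwise f has mean zero on each set of permutations
  with a given particle at vertex n. By the octopus inequality the Dirichlet form of f dominates
  the sum over these sets of the forms of the interchange process on n - 1 vertices with
  weights a_ij + a_in a_jn / (sum_l a_ln), and by harmonic extension this network reduction does
  not decrease the gap of the random walk.
*)
theory Submission
  imports Defs "HOL-Analysis.Function_Topology"
begin

subsection \<open>The second smallest eigenvalue of a symmetric matrix with zero row sums\<close>

text \<open>No connectivity is assumed, so 0 may be a multiple eigenvalue and the second entry of
  the eigenvalue list may itself be 0. The minimum of the quadratic form over mean-zero unit vectors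
  is the right quantity in all cases; matching it with the definition through roots of the
  characteristic polynomial requires splitting off exactly one root 0, the one that belongs to the
  constants. After that the argument is about Dirichlet forms.

  The second eigenvalues of the successive networks need not agree. A fixed constant
  \<open>c\<close> that bounds the random-walk gap from below survives every deletion of a vertex,
  and the bound for the interchange process travels back up with the same \<open>c\<close>. The two
  reductions fit together because the weights created by eliminating a vertex are exactly those on
  the smaller side of the octopus inequality.\<close>

lemma mean_zero_unit_sphere_compact:
  "compact {f :: nat \<Rightarrow> real. (\<forall>i\<ge>m. f i = 0) \<and> (\<Sum>i<m. (f i)\<^sup>2) = 1 \<and> (\<Sum>i<m. f i) = 0}"
    (is "compact ?K")
proof -
  \<comment> \<open>Tychonoff: coordinates from \<open>m\<close> on are pinned to 0 and the unit
    norm bounds the others by 1, so the sphere is a closed subset of this compact product.\<close>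
  let ?B = "PiE UNIV (\<lambda>i::nat. if i < m then {-1..1::real} else {0})"
  let ?C = "{f :: nat \<Rightarrow> real. (\<Sum>i<m. (f i)\<^sup>2) = 1} \<inter> {f. (\<Sum>i<m. f i) = 0}"
  have "compactin (product_topology (\<lambda>_. euclidean) UNIV) ?B"
    unfolding compactin_PiE by auto
  then have B: "compact ?B"
    by (simp add: euclidean_product_topology)
  have C: "closed ?C"
    by (intro closed_Int closed_Collect_eq continuous_intros
        continuous_on_product_coordinates)
  have bound: "\<bar>f i\<bar> \<le> 1" if "(\<Sum>i<m. (f i)\<^sup>2) = 1" "i < m" for f :: "nat \<Rightarrow> real" and i
    using that member_le_sum[of i "{..<m}" "\<lambda>i. (f i)\<^sup>2"] by (simp add: abs_square_le_1)
  have "?K = ?B \<inter> ?C"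
  proof (intro subset_antisym subsetI)
    fix f assume f: "f \<in> ?K"
    then have "- 1 \<le> f i \<and> f i \<le> 1" if "i < m" for i
      using bound[of f i] that by (simp add: abs_le_iff)
    with f show "f \<in> ?B \<inter> ?C" by (simp add: PiE_iff)
  next
    fix f assume "f \<in> ?B \<inter> ?C"
    then have "\<forall>i. f i \<in> (if i < m then {-1..1} else {0})" and "f \<in> ?C"
      by (simp_all add: PiE_iff)
    then show "f \<in> ?K" by simp (metis not_less singletonD)
  qed
  then show ?thesis
    using compact_Int_closed[OF B C] by simp
qed

text \<open>The form attains its minimum on the compact set above, and homogeneity of degree two
  extends the bound from unit vectors to all mean-zero vectors.\<close>

lemma rayleigh_minimizer:
  fixes a :: "nat \<Rightarrow> nat \<Rightarrow> real"
  assumes m: "2 \<le> m"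
  shows "\<exists>f \<mu>. (\<Sum>i<m. (f i)\<^sup>2) = 1 \<and> (\<Sum>i<m. f i) = 0 \<and>
    (\<Sum>i<m. f i * (\<Sum>j<m. a i j * f j)) = \<mu> \<and>
    (\<forall>h. (\<Sum>i<m. h i) = 0 \<longrightarrow> \<mu> * (\<Sum>i<m. (h i)\<^sup>2) \<le> (\<Sum>i<m. h i * (\<Sum>j<m. a i j * h j)))"
proof -
  define K :: "(nat \<Rightarrow> real) set" where
    "K = {f. (\<forall>i\<ge>m. f i = 0) \<and> (\<Sum>i<m. (f i)\<^sup>2) = 1 \<and> (\<Sum>i<m. f i) = 0}"
  define q where "q h = (\<Sum>i<m. h i * (\<Sum>j<m. a i j * h j))" for h :: "nat \<Rightarrow> real"
  have normalize: "\<exists>g\<in>K. q h = N * q g"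
    if "(\<Sum>i<m. h i) = 0" and N: "N = (\<Sum>i<m. (h i)\<^sup>2)" "N > 0" for h N
  proof
    let ?g = "\<lambda>i. if i < m then h i / sqrt N else 0"
    have "(\<Sum>i<m. (?g i)\<^sup>2) = (\<Sum>i<m. (h i)\<^sup>2 / N)"
      using N(2) by (intro sum.cong) (auto simp: power_divide)
    also have "\<dots> = 1" using N by (simp flip: sum_divide_distrib)
    finally show "?g \<in> K"
      using that(1) by (simp add: K_def flip: sum_divide_distrib)
    have "q ?g = (\<Sum>i<m. h i / sqrt N * (\<Sum>j<m. a i j * (h j / sqrt N)))"
      unfolding q_def by (intro sum.cong arg_cong2[of _ _ _ _ "(*)"]) auto
    also have "\<dots> = (\<Sum>i<m. h i * (\<Sum>j<m. a i j * h j) / (sqrt N * sqrt N))"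
      by (intro sum.cong) (simp_all flip: sum_divide_distrib)
    also have "\<dots> = q h / N"
      using N(2) by (simp add: q_def flip: sum_divide_distrib)
    finally show "q h = N * q ?g" using N(2) by simp
  qed
  have "K \<noteq> {}"
  proof -
    \<comment> \<open>The vector (1, -1, 0, ...) has mean zero and squared norm 2; there is room for
      it because 2 \<le> m.\<close>
    let ?h = "\<lambda>i::nat. if i = 0 then 1 else if i = 1 then -1 else 0 :: real"
    have S: "{..<m} = insert 0 (insert 1 {2..<m})" using m by auto
    have "(\<Sum>i<m. ?h i) = 0" "(\<Sum>i<m. (?h i)\<^sup>2) = 2"
      unfolding S by simp_all
    then show ?thesis using normalize[of ?h 2] by auto
  qed
  moreover have "compact K"
    unfolding K_def by (rule mean_zero_unit_sphere_compact)
  moreover have "continuous_on K q"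
    unfolding q_def
    by (intro continuous_intros continuous_on_subset[OF continuous_on_product_coordinates]) auto
  ultimately obtain f where f: "f \<in> K" "\<And>g. g \<in> K \<Longrightarrow> q f \<le> q g"
    using continuous_attains_inf[of K q] by blast
  have "q f * (\<Sum>i<m. (h i)\<^sup>2) \<le> q h" if h: "(\<Sum>i<m. h i) = 0" for h
  proof (cases "(\<Sum>i<m. (h i)\<^sup>2) = 0")
    case True
    then have "h i = 0" if "i < m" for i
      using that by (simp add: sum_nonneg_eq_0_iff)
    then show ?thesis by (simp add: q_def)
  next
    case False
    then have N: "(\<Sum>i<m. (h i)\<^sup>2) > 0"
      by (simp add: order_less_le sum_nonneg)
    from normalize[OF h refl this] obtain g where "g \<in> K" "q h = (\<Sum>i<m. (h i)\<^sup>2) * q g"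
      by blast
    then show ?thesis
      using f(2)[of g] N by (simp add: mult.commute mult_left_mono)
  qed
  with f(1) show ?thesis
    by (intro exI[of _ f] exI[of _ "q f"]) (simp add: K_def q_def)
qed

text \<open>First variation at the minimizer. The residual \<open>r\<close> of the eigenvalue
  equation has mean zero, since symmetry turns vanishing row sums into vanishing column sums. So
  \<open>r\<close> is itself an admissible direction, and \<open>Q\<close> along
  \<open>f + t * r\<close> has as linear coefficient twice the squared norm of \<open>r\<close>,
  which must vanish.\<close>

lemma mean_zero_eigenfunction:
  fixes a :: "nat \<Rightarrow> nat \<Rightarrow> real"
  assumes m: "2 \<le> m"
    and sym: "\<And>i j. i < m \<Longrightarrow> j < m \<Longrightarrow> a i j = a j i"
    and rows: "\<And>i. i < m \<Longrightarrow> (\<Sum>j<m. a i j) = 0"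
  shows "\<exists>f \<mu>. (\<Sum>i<m. (f i)\<^sup>2) = 1 \<and> (\<Sum>i<m. f i) = 0 \<and>
    (\<forall>i<m. (\<Sum>j<m. a i j * f j) = \<mu> * f i) \<and>
    (\<forall>h. (\<Sum>i<m. h i) = 0 \<longrightarrow> \<mu> * (\<Sum>i<m. (h i)\<^sup>2) \<le> (\<Sum>i<m. h i * (\<Sum>j<m. a i j * h j)))"
proof -
  obtain f \<mu>
    where f: "(\<Sum>i<m. (f i)\<^sup>2) = 1" "(\<Sum>i<m. f i) = 0"
      "(\<Sum>i<m. f i * (\<Sum>j<m. a i j * f j)) = \<mu>"
      "\<And>h. (\<Sum>i<m. h i) = 0 \<Longrightarrow> \<mu> * (\<Sum>i<m. (h i)\<^sup>2) \<le> (\<Sum>i<m. h i * (\<Sum>j<m. a i j * h j))"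
    using rayleigh_minimizer[OF m, of a] by blast
  define Q where "Q u v = (\<Sum>i<m. \<Sum>j<m. u i * a i j * v j) - \<mu> * (\<Sum>i<m. u i * v i)"
    for u v :: "nat \<Rightarrow> real"
  define r where "r i = (\<Sum>j<m. a i j * f j) - \<mu> * f i" for i
  have Q_alt: "Q u v = (\<Sum>i<m. u i * (\<Sum>j<m. a i j * v j)) - \<mu> * (\<Sum>i<m. u i * v i)" for u v
    by (simp add: Q_def sum_distrib_left mult.assoc)
  have "(\<Sum>i<m. \<Sum>j<m. a i j * f j) = (\<Sum>j<m. (\<Sum>i<m. a j i) * f j)"
    by (subst sum.swap) (simp add: sum_distrib_right sym)
  then have r0: "(\<Sum>i<m. r i) = 0"
    using f(2) rows by (simp add: r_def sum_subtractf flip: sum_distrib_left)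
  have Q_nonneg: "Q h h \<ge> 0" if "(\<Sum>i<m. h i) = 0" for h
    using f(4)[OF that] by (simp add: Q_alt power2_eq_square)
  have Q_sym: "Q u v = Q v u" for u v
  proof -
    have "(\<Sum>i<m. \<Sum>j<m. u i * a i j * v j) = (\<Sum>i<m. \<Sum>j<m. v i * a i j * u j)"
      by (subst sum.swap) (intro sum.cong refl, metis sym lessThan_iff mult.commute mult.left_commute)
    then show ?thesis by (simp add: Q_def mult.commute)
  qed
  have Q_rf: "Q r f = (\<Sum>i<m. (r i)\<^sup>2)"
    unfolding Q_alt
    by (simp add: r_def power2_eq_square sum_distrib_left algebra_simps sum.distrib sum_subtractf)
  have Q_ff: "Q f f = 0"
    using f(1,3) by (simp add: Q_alt power2_eq_square)
  have expand: "Q (\<lambda>i. f i + t * r i) (\<lambda>i. f i + t * r i) = Q f f + 2 * t * Q r f + t\<^sup>2 * Q r r" for t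
  proof -
    have "Q (\<lambda>i. f i + t * r i) (\<lambda>i. f i + t * r i) = Q f f + t * Q r f + t * Q f r + t\<^sup>2 * Q r r"
      unfolding Q_def
      by (simp add: algebra_simps sum.distrib sum_distrib_left power2_eq_square)
    then show ?thesis using Q_sym[of f r] by simp
  qed
  have "r i = 0" if "i < m" for i
  proof (rule ccontr)
    assume "r i \<noteq> 0"
    define R where "R = (\<Sum>i<m. (r i)\<^sup>2)"
    define D where "D = Q r r"
    have "R > 0"
      unfolding R_def using \<open>r i \<noteq> 0\<close> \<open>i < m\<close> by (intro sum_pos2[of _ i]) auto
    have "D \<ge> 0" unfolding D_def by (rule Q_nonneg[OF r0])
    \<comment> \<open>Every small negative \<open>t\<close> would do. This choice makes the
      quadratic equal to \<open>- (t\<^sup>2 * (D + 2))\<close>, and the summand 1 keeps the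
      denominator positive when \<open>D\<close> is 0.\<close>
    define t where "t = - (R / (D + 1))"
    have R: "R = - t * (D + 1)" "t \<noteq> 0"
      using \<open>R > 0\<close> \<open>D \<ge> 0\<close> unfolding t_def by simp_all
    have "(\<Sum>i<m. f i + t * r i) = 0"
      using f(2) r0 by (simp add: sum.distrib flip: sum_distrib_left)
    then have "0 \<le> 2 * t * R + t\<^sup>2 * D"
      using Q_nonneg[of "\<lambda>i. f i + t * r i"] expand[of t] by (simp add: Q_ff Q_rf R_def D_def)
    also have "\<dots> = - (t\<^sup>2 * (D + 2))"
      unfolding R(1) by (simp add: algebra_simps power2_eq_square)
    also have "\<dots> < 0"
      using R(2) \<open>D \<ge> 0\<close> by simp
    finally show False by simp
  qed
  then show ?thesis
    using f by (intro exI[of _ f] exI[of _ \<mu>]) (simp add: r_def)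
qed

text \<open>
  In the basis \<open>1, e\<^sub>1, \<dots>, e\<^sub>p\<close> a matrix that annihilates the constant vector \<open>1\<close> becomes block
  triangular, with diagonal blocks \<open>0\<close> and its action modulo constants. This splits one
  eigenvalue \<open>0\<close> off with the correct multiplicity.
\<close>

definition shear_mat :: "nat \<Rightarrow> real \<Rightarrow> real mat" where
  "shear_mat m s = mat m m (\<lambda>(i, j). if i = j then 1 else if j = 0 then s else 0)"

lemma shear_mat_carrier [simp]: "shear_mat m s \<in> carrier_mat m m"
  by (simp add: shear_mat_def)

lemma shear_mat_times:
  assumes M: "M \<in> carrier_mat m m" and ij: "i < m" "j < m"
  shows "(shear_mat m s * M) $$ (i, j) = M $$ (i, j) + (if i = 0 then 0 else s * M $$ (0, j))"
proof -
  have "(shear_mat m s * M) $$ (i, j) =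
      (\<Sum>k<m. (if i = k then 1 else if k = 0 then s else 0) * M $$ (k, j))"
    using M ij by (simp add: shear_mat_def scalar_prod_def atLeast0LessThan)
  also have "\<dots> = (\<Sum>k<m. (if k = i then M $$ (i, j) else 0) +
      (if k = 0 then (if i = 0 then 0 else s * M $$ (0, j)) else 0))"
    by (intro sum.cong) auto
  finally show ?thesis
    using ij by (simp add: sum.distrib)
qed

lemma times_shear_mat:
  assumes M: "M \<in> carrier_mat m m" and ij: "i < m" "j < m"
  shows "(M * shear_mat m 1) $$ (i, j) = (if j = 0 then (\<Sum>k<m. M $$ (i, k)) else M $$ (i, j))"
proof -
  have "(M * shear_mat m 1) $$ (i, j) =
      (\<Sum>k<m. M $$ (i, k) * (if k = j then 1 else if j = 0 then 1 else 0))"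
    using M ij by (simp add: shear_mat_def scalar_prod_def atLeast0LessThan)
  also have "\<dots> = (if j = 0 then (\<Sum>k<m. M $$ (i, k)) else M $$ (i, j))"
    using ij by (cases "j = 0") (auto simp: if_distrib cong: if_cong intro: sum.cong)
  finally show ?thesis .
qed

lemma shear_mat_inverse: "shear_mat m s * shear_mat m (- s) = 1\<^sub>m m"
proof (rule eq_matI)
  fix i j assume "i < dim_row (1\<^sub>m m :: real mat)" "j < dim_col (1\<^sub>m m :: real mat)"
  then show "(shear_mat m s * shear_mat m (- s)) $$ (i, j) = 1\<^sub>m m $$ (i, j)"
    by (subst shear_mat_times) (auto simp: shear_mat_def)
qed (auto simp: shear_mat_def)

text \<open>Coordinates modulo constants are the differences \<open>f (Suc i) - f 0\<close>; when
  the rows of \<open>a\<close> sum to zero, this is the matrix of the induced map in these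
  coordinates.\<close>

definition quotient_mat :: "nat \<Rightarrow> (nat \<Rightarrow> nat \<Rightarrow> real) \<Rightarrow> real mat" where
  "quotient_mat p a = mat p p (\<lambda>(i, j). a (Suc i) (Suc j) - a 0 (Suc j))"

text \<open>Conjugation by the shear, whose first column is the constant vector, makes the matrix
  block triangular: the first column of \<open>B\<close> is zero because the row sums vanish. Only
  one factor X is split off; further zero eigenvalues stay in the quotient.\<close>

lemma char_poly_zero_row_sums:
  fixes a :: "nat \<Rightarrow> nat \<Rightarrow> real"
  assumes rows: "\<And>i. i < Suc p \<Longrightarrow> (\<Sum>j<Suc p. a i j) = 0"
  shows "char_poly (mat (Suc p) (Suc p) (\<lambda>(i, j). a i j)) = [:0, 1:] * char_poly (quotient_mat p a)"
proof -
  let ?m = "Suc p"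
  define A where "A = mat ?m ?m (\<lambda>(i, j). a i j)"
  define B where "B = four_block_mat (0\<^sub>m 1 1) (mat 1 p (\<lambda>(i, j). a 0 (Suc j))) (0\<^sub>m p 1) (quotient_mat p a)"
  have Q: "quotient_mat p a \<in> carrier_mat p p" by (simp add: quotient_mat_def)
  have A: "A \<in> carrier_mat ?m ?m" by (simp add: A_def)
  have B: "B \<in> carrier_mat ?m ?m"
    unfolding B_def using four_block_carrier_mat[of "0\<^sub>m 1 1 :: real mat" 1 1 "quotient_mat p a" p p] Q
    by simp
  have B_entry: "B $$ (i, j) =
      (if j = 0 then 0 else if i = 0 then a 0 j else a i j - a 0 j)" if "i < ?m" "j < ?m" for i j
    using that by (auto simp: B_def quotient_mat_def four_block_mat_def)
  have "A * shear_mat ?m 1 = shear_mat ?m 1 * B"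
  proof (rule eq_matI)
    fix i j assume "i < dim_row (shear_mat ?m 1 * B)" "j < dim_col (shear_mat ?m 1 * B)"
    then have ij: "i < ?m" "j < ?m" using B by (auto simp: shear_mat_def)
    have "(\<Sum>k<?m. A $$ (i, k)) = 0"
      using rows[OF ij(1)] ij by (simp add: A_def)
    then show "(A * shear_mat ?m 1) $$ (i, j) = (shear_mat ?m 1 * B) $$ (i, j)"
      unfolding times_shear_mat[OF A ij] shear_mat_times[OF B ij]
      using ij by (simp add: B_entry) (simp add: A_def)
  qed (use A B in \<open>auto simp: shear_mat_def\<close>)
  then have "shear_mat ?m 1 * B * shear_mat ?m (- 1) = A * shear_mat ?m 1 * shear_mat ?m (- 1)"
    by simp
  also have "\<dots> = A * (shear_mat ?m 1 * shear_mat ?m (- 1))"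
    using A by (intro assoc_mult_mat[of _ ?m ?m _ ?m _ ?m]) auto
  also have "\<dots> = A"
    using A by (simp add: shear_mat_inverse)
  finally have "similar_mat_wit A B (shear_mat ?m 1) (shear_mat ?m (- 1))"
    using shear_mat_inverse[of ?m 1] shear_mat_inverse[of ?m "- 1"] A B
    by (intro similar_mat_witI[of _ _ ?m]) auto
  then have "char_poly A = char_poly B"
    by (intro char_poly_similar) (auto simp: similar_mat_def)
  also have "\<dots> = char_poly (0\<^sub>m 1 1 :: real mat) * char_poly (quotient_mat p a)"
    unfolding B_def by (rule char_poly_four_block_zeros_col) (auto simp: Q)
  also have "char_poly (0\<^sub>m 1 1 :: real mat) = [:0, 1:]"
    by (simp add: char_poly_defs det_def sign_def)
  finally show ?thesis by (simp add: A_def)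
qed

lemma quotient_mat_mult_vec:
  fixes a :: "nat \<Rightarrow> nat \<Rightarrow> real"
  assumes rows: "\<And>i. i < Suc p \<Longrightarrow> (\<Sum>j<Suc p. a i j) = 0" and i: "i < p"
  shows "(quotient_mat p a *\<^sub>v vec p (\<lambda>i. f (Suc i) - f 0)) $ i =
    (\<Sum>j<Suc p. a (Suc i) j * f j) - (\<Sum>j<Suc p. a 0 j * f j)"
proof -
  have "(quotient_mat p a *\<^sub>v vec p (\<lambda>i. f (Suc i) - f 0)) $ i =
      (\<Sum>j<p. (a (Suc i) (Suc j) - a 0 (Suc j)) * (f (Suc j) - f 0))"
    using i by (simp add: quotient_mat_def scalar_prod_def atLeast0LessThan)
  \<comment> \<open>The added summand for j = 0 contains the factor \<open>f 0 - f 0\<close>. The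
    vanishing row sums then remove the shift by \<open>f 0\<close>.\<close>
  also have "\<dots> = (\<Sum>j<Suc p. (a (Suc i) j - a 0 j) * (f j - f 0))"
    by (subst sum.lessThan_Suc_shift) simp
  also have "\<dots> = (\<Sum>j<Suc p. a (Suc i) j * f j) - (\<Sum>j<Suc p. a 0 j * f j)
      - ((\<Sum>j<Suc p. a (Suc i) j) - (\<Sum>j<Suc p. a 0 j)) * f 0"
    unfolding sum_distrib_right sum_subtractf[symmetric] by (intro sum.cong) (auto simp: algebra_simps)
  finally show ?thesis using rows i by simp
qed

text \<open>The class of \<open>f\<close> modulo constants is an eigenvector; it is nonzero because
  the only constant function with mean zero is zero.\<close>

lemma eigenvalue_quotient_matI:
  fixes a :: "nat \<Rightarrow> nat \<Rightarrow> real"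
  assumes rows: "\<And>i. i < Suc p \<Longrightarrow> (\<Sum>j<Suc p. a i j) = 0"
    and f: "\<And>i. i < Suc p \<Longrightarrow> (\<Sum>j<Suc p. a i j * f j) = e * f i"
    and nz: "(\<Sum>i<Suc p. f i) = 0" "i < Suc p" "f i \<noteq> 0"
  shows "eigenvalue (quotient_mat p a) e"
proof -
  let ?w = "vec p (\<lambda>i. f (Suc i) - f 0)"
  have "?w \<noteq> 0\<^sub>v p"
  proof
    assume "?w = 0\<^sub>v p"
    then have "?w $ i = 0\<^sub>v p $ i" for i by (simp only:)
    then have "f (Suc i) = f 0" if "i < p" for i
      using that by (metis index_vec index_zero_vec(1) right_minus_eq)
    then have const: "f i = f 0" if "i < Suc p" for i
      using that by (cases i) auto
    have "(\<Sum>i<Suc p. f i) = (\<Sum>i<Suc p. f 0)"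
      by (intro sum.cong refl) (rule const, simp)
    also have "\<dots> = real (Suc p) * f 0" by simp
    finally have "f 0 = 0" using nz(1) by simp
    with const[OF nz(2)] nz(3) show False by simp
  qed
  moreover have "quotient_mat p a *\<^sub>v ?w = e \<cdot>\<^sub>v ?w"
  proof (rule eq_vecI)
    fix i assume "i < dim_vec (e \<cdot>\<^sub>v ?w)"
    then have i: "i < p" by simp
    have "(quotient_mat p a *\<^sub>v ?w) $ i = e * f (Suc i) - e * f 0"
      using quotient_mat_mult_vec[OF rows i, where f = f] f[of 0] f[of "Suc i"] i
      by (simp del: index_mult_mat_vec)
    also have "\<dots> = (e \<cdot>\<^sub>v ?w) $ i" using i by (simp add: algebra_simps)
    finally show "(quotient_mat p a *\<^sub>v ?w) $ i = (e \<cdot>\<^sub>v ?w) $ i" .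
  qed (simp add: quotient_mat_def)
  ultimately have "eigenvector (quotient_mat p a) ?w e"
    by (simp add: eigenvector_def quotient_mat_def)
  then show ?thesis unfolding eigenvalue_def ..
qed

text \<open>An eigenvector of the quotient lifts to \<open>g\<close> with \<open>g 0 = 0\<close>,
  which solves the eigenvalue equation up to a constant \<open>t\<close>. Subtracting the mean
  \<open>s\<close> changes the defect to \<open>t + e * s\<close>; summing the equation over all
  rows, with zero column sums and a mean-zero \<open>f\<close>, shows that this defect is 0.\<close>

lemma eigenvalue_quotient_matE:
  fixes a :: "nat \<Rightarrow> nat \<Rightarrow> real"
  assumes rows: "\<And>i. i < Suc p \<Longrightarrow> (\<Sum>j<Suc p. a i j) = 0"
    and cols: "\<And>j. j < Suc p \<Longrightarrow> (\<Sum>i<Suc p. a i j) = 0"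
    and e: "eigenvalue (quotient_mat p a) e"
  shows "\<exists>f. (\<exists>i<Suc p. f i \<noteq> 0) \<and> (\<Sum>i<Suc p. f i) = 0 \<and>
    (\<forall>i<Suc p. (\<Sum>j<Suc p. a i j * f j) = e * f i)"
proof -
  from e obtain w where w: "w \<in> carrier_vec p" "w \<noteq> 0\<^sub>v p" "quotient_mat p a *\<^sub>v w = e \<cdot>\<^sub>v w"
    by (auto simp: eigenvalue_def eigenvector_def quotient_mat_def)
  define g where "g i = (case i of 0 \<Rightarrow> 0 | Suc i \<Rightarrow> w $ i)" for i
  define t where "t = (\<Sum>j<Suc p. a 0 j * g j)"
  define s where "s = (\<Sum>i<Suc p. g i) / real (Suc p)"
  define f where "f i = g i - s" for i
  have w_g: "w = vec p (\<lambda>i. g (Suc i) - g 0)"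
    using w(1) by (intro eq_vecI) (auto simp: g_def)
  have ag: "(\<Sum>j<Suc p. a i j * g j) = e * g i + t" if "i < Suc p" for i
  proof (cases i)
    case 0
    then show ?thesis by (simp add: t_def g_def)
  next
    case (Suc k)
    with that have k: "k < p" by simp
    have "(quotient_mat p a *\<^sub>v w) $ k = e * w $ k"
      unfolding w(3) using w(1) k by simp
    moreover have "(quotient_mat p a *\<^sub>v w) $ k = (\<Sum>j<Suc p. a i j * g j) - t"
      using quotient_mat_mult_vec[OF rows k, where f = g] by (simp only: w_g[symmetric] t_def Suc)
    moreover have "w $ k = g i" by (simp add: g_def Suc)
    ultimately show ?thesis by simp
  qed
  have f0: "(\<Sum>i<Suc p. f i) = 0"
    unfolding f_def sum_subtractf by (simp add: s_def)
  have af: "(\<Sum>j<Suc p. a i j * f j) = e * f i + (t + e * s)" if "i < Suc p" for i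
  proof -
    have "(\<Sum>j<Suc p. a i j * f j) = (\<Sum>j<Suc p. a i j * g j) - (\<Sum>j<Suc p. a i j) * s"
      unfolding f_def sum_distrib_right sum_subtractf[symmetric]
      by (intro sum.cong) (auto simp: algebra_simps)
    then show ?thesis
      unfolding ag[OF that] rows[OF that] by (simp add: f_def algebra_simps)
  qed
  have "(\<Sum>i<Suc p. \<Sum>j<Suc p. a i j * f j) = (\<Sum>j<Suc p. (\<Sum>i<Suc p. a i j) * f j)"
    unfolding sum_distrib_right by (rule sum.swap)
  also have "\<dots> = 0" using cols by (intro sum.neutral) auto
  also have "(\<Sum>i<Suc p. \<Sum>j<Suc p. a i j * f j) = (\<Sum>i<Suc p. e * f i + (t + e * s))"
    using af by (intro sum.cong) auto
  also have "\<dots> = real (Suc p) * (t + e * s)"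
    unfolding sum.distrib sum_distrib_left[symmetric] f0 by (simp add: algebra_simps)
  finally have ts: "t + e * s = 0" by simp
  have "\<exists>i<Suc p. f i \<noteq> 0"
  proof (rule ccontr)
    assume "\<not> (\<exists>i<Suc p. f i \<noteq> 0)"
    then have z: "f i = 0" if "i < Suc p" for i using that by blast
    have "s = 0" using z[of 0] by (simp add: f_def g_def)
    then have "w $ i = 0" if "i < p" for i
      using z[of "Suc i"] that by (simp add: f_def g_def)
    then have "w = 0\<^sub>v p" using w(1) by (intro eq_vecI) auto
    with w(2) show False by simp
  qed
  moreover have "\<forall>i<Suc p. (\<Sum>j<Suc p. a i j * f j) = e * f i"
    using af ts by simp
  ultimately show ?thesis using f0 by blast
qed

section \<open>The second entry of the eigenvalue list as a variational minimum\<close>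

text \<open>The roots are one 0 from the constants and the eigenvalues of the quotient. The
  variational minimum \<open>\<nu>\<close> is the least of the latter, and \<open>psd\<close> gives
  0 \<le> \<open>\<nu>\<close>, so the sorted list starts with 0, \<open>\<nu>\<close>, even if
  \<open>\<nu>\<close> is 0.\<close>

lemma second_smallest_eigenvalue_mat:
  fixes a :: "nat \<Rightarrow> nat \<Rightarrow> real"
  assumes m: "2 \<le> m"
    and sym: "\<And>i j. i < m \<Longrightarrow> j < m \<Longrightarrow> a i j = a j i"
    and rows: "\<And>i. i < m \<Longrightarrow> (\<Sum>j<m. a i j) = 0"
    and psd: "\<And>h. 0 \<le> (\<Sum>i<m. h i * (\<Sum>j<m. a i j * h j))"
  defines "\<mu> \<equiv> second_smallest_eigenvalue (mat m m (\<lambda>(i, j). a i j))"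
  shows "\<exists>f. (\<Sum>i<m. (f i)\<^sup>2) = 1 \<and> (\<Sum>i<m. f i) = 0 \<and>
      (\<forall>i<m. (\<Sum>j<m. a i j * f j) = \<mu> * f i)"
    and "(\<Sum>i<m. h i) = 0 \<Longrightarrow> \<mu> * (\<Sum>i<m. (h i)\<^sup>2) \<le> (\<Sum>i<m. h i * (\<Sum>j<m. a i j * h j))"
proof -
  obtain p where p: "m = Suc p" using m by (cases m) auto
  have cols: "(\<Sum>i<m. a i j) = 0" if "j < m" for j
    using rows[OF that] sym that by simp
  obtain f \<nu> where f: "(\<Sum>i<m. (f i)\<^sup>2) = 1" "(\<Sum>i<m. f i) = 0"
    "\<And>i. i < m \<Longrightarrow> (\<Sum>j<m. a i j * f j) = \<nu> * f i"
    and ray: "\<And>h. (\<Sum>i<m. h i) = 0 \<Longrightarrow> \<nu> * (\<Sum>i<m. (h i)\<^sup>2) \<le> (\<Sum>i<m. h i * (\<Sum>j<m. a i j * h j))"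
    using mean_zero_eigenfunction[OF m, of a, OF sym rows] by blast
  have quot: "quotient_mat p a \<in> carrier_mat p p" by (simp add: quotient_mat_def)
  have nz: "char_poly (quotient_mat p a) \<noteq> 0"
    using degree_monic_char_poly[OF quot] by (metis coeff_0 zero_neq_one)
  have mem: "e \<in># proots (char_poly (quotient_mat p a)) \<longleftrightarrow> eigenvalue (quotient_mat p a) e" for e
    using nz by (simp add: eigenvalue_root_char_poly[OF quot])
  have \<nu>_le: "\<nu> \<le> e" if "eigenvalue (quotient_mat p a) e" for e
  proof -
    from that obtain g i where g: "i < m" "g i \<noteq> 0" "(\<Sum>i<m. g i) = 0"
      "\<And>i. i < m \<Longrightarrow> (\<Sum>j<m. a i j * g j) = e * g i"
      using eigenvalue_quotient_matE[of p a e] rows cols unfolding p by blast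
    have "(\<Sum>i<m. g i * (\<Sum>j<m. a i j * g j)) = e * (\<Sum>i<m. (g i)\<^sup>2)"
      using g(4) by (simp add: sum_distrib_left power2_eq_square mult_ac)
    with ray[OF g(3)] have "\<nu> * (\<Sum>i<m. (g i)\<^sup>2) \<le> e * (\<Sum>i<m. (g i)\<^sup>2)" by simp
    moreover have "0 < (\<Sum>i<m. (g i)\<^sup>2)"
      using g(1,2) by (intro sum_pos2[of _ i]) auto
    ultimately show ?thesis by simp
  qed
  have "\<nu> = (\<Sum>i<m. f i * (\<Sum>j<m. a i j * f j))"
    using f(1,3) by (simp add: power2_eq_square mult.left_commute flip: sum_distrib_left)
  with psd[of f] have "\<nu> \<ge> 0" by simp
  have "\<exists>i<m. f i \<noteq> 0"
    using f(1) by (metis (no_types, lifting) lessThan_iff power_zero_numeral sum.neutral zero_neq_one)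
  then have "eigenvalue (quotient_mat p a) \<nu>"
    using eigenvalue_quotient_matI[of p a f \<nu>] rows f(2,3) unfolding p by blast
  then obtain M where M: "proots (char_poly (quotient_mat p a)) = add_mset \<nu> M"
    using mem by (metis multi_member_split)
  have M_ge: "\<nu> \<le> e" if "e \<in># M" for e
    using M mem[of e] \<nu>_le[of e] that by simp
  have lin: "[:0, 1:] \<noteq> (0 :: real poly)" by simp
  have "proots (char_poly (mat m m (\<lambda>(i, j). a i j))) = add_mset 0 (add_mset \<nu> M)"
    using proots_mult[OF lin nz] rows M
    by (simp add: p char_poly_zero_row_sums del: sum.lessThan_Suc mult_pCons_left)
  moreover have "insort \<nu> (sorted_list_of_multiset M) = \<nu> # sorted_list_of_multiset M"
    using M_ge by (intro insort_is_Cons) auto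
  moreover have "insort 0 (\<nu> # sorted_list_of_multiset M) = 0 # \<nu> # sorted_list_of_multiset M"
    using \<open>\<nu> \<ge> 0\<close> by simp
  ultimately have "\<mu> = \<nu>"
    by (simp add: \<mu>_def second_smallest_eigenvalue_def eigenvalue_list_def)
  with f show "\<exists>f. (\<Sum>i<m. (f i)\<^sup>2) = 1 \<and> (\<Sum>i<m. f i) = 0 \<and>
      (\<forall>i<m. (\<Sum>j<m. a i j * f j) = \<mu> * f i)"
    by (intro exI[of _ f]) simp
  show "\<mu> * (\<Sum>i<m. (h i)\<^sup>2) \<le> (\<Sum>i<m. h i * (\<Sum>j<m. a i j * h j))" if "(\<Sum>i<m. h i) = 0"
    using ray[OF that] \<open>\<mu> = \<nu>\<close> by simp
qed

text \<open>Transport along the enumeration. The conclusions only contain sums over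
  \<open>S\<close>, so the arbitrary order chosen in \<open>Sym_list\<close> no longer matters
  afterwards.\<close>

lemma second_smallest_eigenvalue_indexed_mat:
  fixes a :: "'i \<Rightarrow> 'i \<Rightarrow> real"
  assumes xs: "distinct xs" "set xs = S" and card: "2 \<le> card S"
    and sym: "\<And>x y. x \<in> S \<Longrightarrow> y \<in> S \<Longrightarrow> a x y = a y x"
    and rows: "\<And>x. x \<in> S \<Longrightarrow> (\<Sum>y\<in>S. a x y) = 0"
    and psd: "\<And>h. 0 \<le> (\<Sum>x\<in>S. h x * (\<Sum>y\<in>S. a x y * h y))"
  defines "\<mu> \<equiv> second_smallest_eigenvalue (indexed_mat xs a)"
  shows "\<exists>f. (\<Sum>x\<in>S. (f x)\<^sup>2) = 1 \<and> (\<Sum>x\<in>S. f x) = 0 \<and>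
      (\<forall>x\<in>S. (\<Sum>y\<in>S. a x y * f y) = \<mu> * f x)"
    and "(\<Sum>x\<in>S. h x) = 0 \<Longrightarrow> \<mu> * (\<Sum>x\<in>S. (h x)\<^sup>2) \<le> (\<Sum>x\<in>S. h x * (\<Sum>y\<in>S. a x y * h y))"
proof -
  let ?m = "length xs" and ?b = "\<lambda>i j. a (xs ! i) (xs ! j)"
  have m: "2 \<le> ?m" using card xs distinct_card by fastforce
  have bij: "bij_betw ((!) xs) {..<?m} S"
    using bij_betw_nth[OF xs(1)] xs(2) by simp
  have S_sum: "(\<Sum>x\<in>S. F x) = (\<Sum>i<?m. F (xs ! i))" for F :: "'i \<Rightarrow> real"
    using sum.reindex_bij_betw[OF bij, of F] by simp
  have mem: "xs ! i \<in> S" if "i < ?m" for i using that xs(2) by auto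
  define ix where "ix = inv_into {..<?m} ((!) xs)"
  have ix: "ix (xs ! i) = i" if "i < ?m" for i
    unfolding ix_def using bij_betw_imp_inj_on[OF bij] that by simp
  have psd': "0 \<le> (\<Sum>i<?m. h i * (\<Sum>j<?m. ?b i j * h j))" for h
  proof -
    have "(\<Sum>x\<in>S. h (ix x) * (\<Sum>y\<in>S. a x y * h (ix y))) = (\<Sum>i<?m. h i * (\<Sum>j<?m. ?b i j * h j))"
      by (simp add: S_sum ix)
    with psd[of "h \<circ> ix"] show ?thesis by simp
  qed
  have rows': "(\<Sum>j<?m. ?b i j) = 0" if "i < ?m" for i
    using rows[OF mem[OF that]] by (simp add: S_sum)
  have \<mu>: "\<mu> = second_smallest_eigenvalue (mat ?m ?m (\<lambda>(i, j). ?b i j))"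
    by (simp add: \<mu>_def indexed_mat_def)
  note * = second_smallest_eigenvalue_mat[of ?m ?b, folded \<mu>, OF m sym[OF mem mem] rows' psd']
  obtain f where f: "(\<Sum>i<?m. (f i)\<^sup>2) = 1 \<and> (\<Sum>i<?m. f i) = 0 \<and>
      (\<forall>i<?m. (\<Sum>j<?m. ?b i j * f j) = \<mu> * f i)"
    using *(1) ..
  have "(\<Sum>y\<in>S. a x y * f (ix y)) = \<mu> * f (ix x)" if x: "x \<in> S" for x
  proof -
    obtain i where "i < ?m" "x = xs ! i"
      using x xs(2) by (metis in_set_conv_nth)
    then show ?thesis using f by (simp add: S_sum ix)
  qed
  with f show "\<exists>f. (\<Sum>x\<in>S. (f x)\<^sup>2) = 1 \<and> (\<Sum>x\<in>S. f x) = 0 \<and>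
      (\<forall>x\<in>S. (\<Sum>y\<in>S. a x y * f y) = \<mu> * f x)"
    by (intro exI[of _ "f \<circ> ix"]) (simp add: S_sum ix)
  show "\<mu> * (\<Sum>x\<in>S. (h x)\<^sup>2) \<le> (\<Sum>x\<in>S. h x * (\<Sum>y\<in>S. a x y * h y))" if "(\<Sum>x\<in>S. h x) = 0"
    using *(2)[of "\<lambda>i. h (xs ! i)"] that by (simp add: S_sum)
qed

subsection \<open>Dirichlet forms\<close>

text \<open>An edge is stored with its larger endpoint first.\<close>

definition edges :: "nat \<Rightarrow> (nat \<times> nat) set" where
  "edges n = (SIGMA j:{1..n}. {1..<j})"

lemma edgesD:
  "(j, i) \<in> edges n \<Longrightarrow> i \<in> {1..n}"
  "(j, i) \<in> edges n \<Longrightarrow> j \<in> {1..n}"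
  "(j, i) \<in> edges n \<Longrightarrow> i \<noteq> j"
  by (auto simp: edges_def)

lemma sum_edges: "(\<Sum>(j, i)\<in>edges n. F i j) = (\<Sum>j\<in>{1..n}. \<Sum>i\<in>{1..<j}. F i j)"
  unfolding edges_def by (subst sum.Sigma) auto

lemma sum_edges_Suc:
  "(\<Sum>(j, i)\<in>edges (Suc n). F i j) = (\<Sum>(j, i)\<in>edges n. F i j) + (\<Sum>i\<in>{1..n}. F i (Suc n))"
  by (simp add: sum_edges atLeastLessThanSuc_atLeastAtMost)

lemma sum_off_diagonal:
  "(\<Sum>x\<in>{1..n}. \<Sum>y\<in>{1..n} - {x}. F x y) = (\<Sum>(j, i)\<in>edges n. F i j + F j i)"
  for F :: "nat \<Rightarrow> nat \<Rightarrow> real"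
proof (induction n)
  case 0
  show ?case by (simp add: sum_edges)
next
  case (Suc n)
  have "(\<Sum>y\<in>{1..Suc n} - {x}. F x y) = (\<Sum>y\<in>{1..n} - {x}. F x y) + F x (Suc n)"
    if "x \<in> {1..n}" for x
  proof -
    have "{1..Suc n} - {x} = insert (Suc n) ({1..n} - {x})" using that by auto
    then show ?thesis by simp
  qed
  moreover have "{1..Suc n} - {Suc n} = {1..n}" by auto
  ultimately have "(\<Sum>x\<in>{1..Suc n}. \<Sum>y\<in>{1..Suc n} - {x}. F x y) =
      (\<Sum>x\<in>{1..n}. \<Sum>y\<in>{1..n} - {x}. F x y) + (\<Sum>i\<in>{1..n}. F i (Suc n) + F (Suc n) i)"
    by (simp add: sum.distrib del: atLeastAtMostSuc_conv)
  then show ?case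
    unfolding Suc.IH sum_edges_Suc .
qed

lemma sum_edges_symmetric:
  fixes F :: "nat \<Rightarrow> nat \<Rightarrow> real"
  assumes "\<And>x y. F x y = F y x" "\<And>x. F x x = 0"
  shows "(\<Sum>x\<in>{1..n}. \<Sum>y\<in>{1..n}. F x y) = 2 * (\<Sum>(j, i)\<in>edges n. F i j)"
proof -
  have "(\<Sum>x\<in>{1..n}. \<Sum>y\<in>{1..n}. F x y) = (\<Sum>x\<in>{1..n}. \<Sum>y\<in>{1..n} - {x}. F x y)"
    using assms(2) by (intro sum.cong refl sum.mono_neutral_right) auto
  also have "\<dots> = (\<Sum>(j, i)\<in>edges n. 2 * F i j)"
    unfolding sum_off_diagonal using assms(1) by (intro sum.cong) auto
  finally show ?thesis
    by (simp add: sum_distrib_left case_prod_unfold)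
qed

definition rw_form :: "nat \<Rightarrow> (nat \<Rightarrow> nat \<Rightarrow> real) \<Rightarrow> (nat \<Rightarrow> real) \<Rightarrow> real" where
  "rw_form n \<alpha> h = (\<Sum>(j, i)\<in>edges n. \<alpha> i j * (h i - h j)\<^sup>2)"

definition ic_op :: "nat \<Rightarrow> (nat \<Rightarrow> nat \<Rightarrow> real) \<Rightarrow> ((nat \<Rightarrow> nat) \<Rightarrow> real) \<Rightarrow> (nat \<Rightarrow> nat) \<Rightarrow> real" where
  "ic_op n \<alpha> f \<sigma> = (\<Sum>(j, i)\<in>edges n. \<alpha> i j * (f \<sigma> - f (swap i j \<circ> \<sigma>)))"

text \<open>The sum meets each pair of permutations joined by an edge twice, from
  \<open>\<sigma>\<close> and from \<open>swap i j \<circ> \<sigma>\<close>. It is therefore twice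
  the quadratic form of the interchange Laplacian, whereas \<open>rw_form\<close> is the undoubled
  form of the random walk; hence the factors 2 in later bounds.\<close>

definition ic_form :: "nat \<Rightarrow> (nat \<Rightarrow> nat \<Rightarrow> real) \<Rightarrow> ((nat \<Rightarrow> nat) \<Rightarrow> real) \<Rightarrow> real" where
  "ic_form n \<alpha> f = (\<Sum>\<sigma>\<in>Sym n. \<Sum>(j, i)\<in>edges n. \<alpha> i j * (f \<sigma> - f (swap i j \<circ> \<sigma>))\<^sup>2)"

definition sym_weights :: "nat \<Rightarrow> (nat \<Rightarrow> nat \<Rightarrow> real) \<Rightarrow> bool" where
  "sym_weights n \<alpha> \<longleftrightarrow>
    (\<forall>i\<in>{1..n}. \<forall>j\<in>{1..n}. i \<noteq> j \<longrightarrow> \<alpha> i j = \<alpha> j i \<and> 0 \<le> \<alpha> i j)"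

lemma sym_weightsD:
  assumes "sym_weights n \<alpha>" "i \<in> {1..n}" "j \<in> {1..n}" "i \<noteq> j"
  shows "\<alpha> i j = \<alpha> j i" "0 \<le> \<alpha> i j"
  using assms by (auto simp: sym_weights_def)

lemma edge_weight_nonneg:
  assumes "sym_weights n \<alpha>" "(j, i) \<in> edges n"
  shows "0 \<le> \<alpha> i j"
  using sym_weightsD(2)[OF assms(1)] edgesD[OF assms(2)] by blast

lemma rw_form_nonneg: "sym_weights n \<alpha> \<Longrightarrow> 0 \<le> rw_form n \<alpha> h"
  unfolding rw_form_def
  by (intro sum_nonneg) (auto intro!: mult_nonneg_nonneg intro: edge_weight_nonneg)

lemma ic_form_nonneg: "sym_weights n \<alpha> \<Longrightarrow> 0 \<le> ic_form n \<alpha> f"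
  unfolding ic_form_def
  by (intro sum_nonneg) (auto intro!: mult_nonneg_nonneg intro: edge_weight_nonneg)

section \<open>Variational description of the two second eigenvalues\<close>

text \<open>Only the value of the form at a minimizer is recorded here. For the interchange process
  the eigenvalue equation itself is kept, because marginals will be taken of it.\<close>

lemma rw_laplacian_second_eigenvalue:
  assumes n: "2 \<le> n" and \<alpha>: "sym_weights n \<alpha>"
  defines "c \<equiv> second_smallest_eigenvalue (rw_laplacian n \<alpha>)"
  shows "\<exists>h. (\<Sum>x\<in>{1..n}. (h x)\<^sup>2) = 1 \<and> (\<Sum>x\<in>{1..n}. h x) = 0 \<and> rw_form n \<alpha> h = c"
    and "(\<Sum>x\<in>{1..n}. h x) = 0 \<Longrightarrow> c * (\<Sum>x\<in>{1..n}. (h x)\<^sup>2) \<le> rw_form n \<alpha> h"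
proof -
  define a where "a i j = (if i = j then (\<Sum>k\<in>{1..n} - {j}. \<alpha> k j) else - \<alpha> i j)" for i j
  have apply_a: "(\<Sum>y\<in>{1..n}. a x y * h y) = (\<Sum>y\<in>{1..n} - {x}. \<alpha> x y * (h x - h y))"
    if x: "x \<in> {1..n}" for x h
  proof -
    have "(\<Sum>y\<in>{1..n}. a x y * h y) = a x x * h x + (\<Sum>y\<in>{1..n} - {x}. a x y * h y)"
      using x by (intro sum.remove) auto
    also have "a x x = (\<Sum>y\<in>{1..n} - {x}. \<alpha> x y)"
      unfolding a_def using x by (auto intro!: sum.cong sym_weightsD(1)[OF \<alpha>])
    also have "(\<Sum>y\<in>{1..n} - {x}. a x y * h y) = (\<Sum>y\<in>{1..n} - {x}. - \<alpha> x y * h y)"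
      by (intro sum.cong) (auto simp: a_def)
    finally show ?thesis
      by (simp add: right_diff_distrib sum_subtractf sum_negf sum_distrib_right)
  qed
  have form: "(\<Sum>x\<in>{1..n}. h x * (\<Sum>y\<in>{1..n}. a x y * h y)) = rw_form n \<alpha> h" for h
  proof -
    have "(\<Sum>x\<in>{1..n}. h x * (\<Sum>y\<in>{1..n}. a x y * h y)) =
        (\<Sum>x\<in>{1..n}. \<Sum>y\<in>{1..n} - {x}. h x * (\<alpha> x y * (h x - h y)))"
      by (simp only: apply_a sum_distrib_left cong: sum.cong)
    also have "\<dots> = rw_form n \<alpha> h"
      unfolding sum_off_diagonal rw_form_def
    proof (intro sum.cong refl, clarify)
      fix j i assume "(j, i) \<in> edges n"
      then have "\<alpha> j i = \<alpha> i j"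
        by (intro sym_weightsD(1)[OF \<alpha>]) (auto dest: edgesD)
      then show "h i * (\<alpha> i j * (h i - h j)) + h j * (\<alpha> j i * (h j - h i)) = \<alpha> i j * (h i - h j)\<^sup>2"
        by (simp add: power2_eq_square algebra_simps)
    qed
    finally show ?thesis .
  qed
  have xs: "distinct [1..<Suc n]" "set [1..<Suc n] = {1..n}" by auto
  have card: "2 \<le> card {1..n}" using n by simp
  have sym: "a x y = a y x" if "x \<in> {1..n}" "y \<in> {1..n}" for x y
    using sym_weightsD(1)[OF \<alpha> that] by (auto simp: a_def)
  have rows: "(\<Sum>y\<in>{1..n}. a x y) = 0" if "x \<in> {1..n}" for x
    using apply_a[OF that, of "\<lambda>_. 1"] by simp
  have psd: "0 \<le> (\<Sum>x\<in>{1..n}. h x * (\<Sum>y\<in>{1..n}. a x y * h y))" for h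
    unfolding form by (rule rw_form_nonneg[OF \<alpha>])
  have c: "c = second_smallest_eigenvalue (indexed_mat [1..<Suc n] a)"
    unfolding c_def rw_laplacian_def a_def ..
  note * = second_smallest_eigenvalue_indexed_mat[of _ _ a, OF xs card _ _ psd, folded c]
  have "\<exists>h. (\<Sum>x\<in>{1..n}. (h x)\<^sup>2) = 1 \<and> (\<Sum>x\<in>{1..n}. h x) = 0 \<and>
      (\<forall>x\<in>{1..n}. (\<Sum>y\<in>{1..n}. a x y * h y) = c * h x)"
    by (rule *(1)) (fact sym rows)+
  then obtain e where e: "(\<Sum>x\<in>{1..n}. (e x)\<^sup>2) = 1" "(\<Sum>x\<in>{1..n}. e x) = 0"
      "\<forall>x\<in>{1..n}. (\<Sum>y\<in>{1..n}. a x y * e y) = c * e x"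
    by (elim exE conjE)
  have "rw_form n \<alpha> e = c * (\<Sum>x\<in>{1..n}. (e x)\<^sup>2)"
    unfolding form[symmetric] using e(3) by (simp add: power2_eq_square sum_distrib_left mult_ac)
  with e(1,2) show "\<exists>h. (\<Sum>x\<in>{1..n}. (h x)\<^sup>2) = 1 \<and> (\<Sum>x\<in>{1..n}. h x) = 0 \<and> rw_form n \<alpha> h = c"
    by (intro exI[of _ e]) simp
  show "c * (\<Sum>x\<in>{1..n}. (h x)\<^sup>2) \<le> rw_form n \<alpha> h" if "(\<Sum>x\<in>{1..n}. h x) = 0"
    unfolding form[symmetric] by (rule *(2)) (fact sym rows that)+
qed

lemma swap_comp_mem_Sym:
  assumes "i \<in> {1..n}" "j \<in> {1..n}" "\<sigma> \<in> Sym n"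
  shows "swap i j \<circ> \<sigma> \<in> Sym n" "\<sigma> \<circ> swap i j \<in> Sym n"
  using assms by (auto simp: Sym_def intro!: permutes_compose permutes_swap_id)

lemma swap_comp_swap_comp [simp]: "swap i j \<circ> (swap i j \<circ> \<sigma>) = \<sigma>"
  by (simp flip: comp_assoc)

lemma sum_Sym_swap_comp:
  assumes "i \<in> {1..n}" "j \<in> {1..n}"
  shows "(\<Sum>\<sigma>\<in>Sym n. F (swap i j \<circ> \<sigma>)) = (\<Sum>\<sigma>\<in>Sym n. F \<sigma>)"
  by (rule sum.reindex_bij_witness[of _ "\<lambda>\<sigma>. swap i j \<circ> \<sigma>" "\<lambda>\<sigma>. swap i j \<circ> \<sigma>"])
    (use assms in \<open>simp_all add: swap_comp_mem_Sym\<close>)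

text \<open>Summation by parts: left multiplication by a transposition permutes
  \<open>Sym n\<close>, so \<open>f\<close> and its swapped version have the same sum of
  squares.\<close>

lemma sum_Sym_swap_parts:
  fixes f :: "(nat \<Rightarrow> nat) \<Rightarrow> real"
  assumes "i \<in> {1..n}" "j \<in> {1..n}"
  shows "2 * (\<Sum>\<sigma>\<in>Sym n. f \<sigma> * (f \<sigma> - f (swap i j \<circ> \<sigma>))) =
    (\<Sum>\<sigma>\<in>Sym n. (f \<sigma> - f (swap i j \<circ> \<sigma>))\<^sup>2)"
proof -
  define g where "g \<sigma> = f (swap i j \<circ> \<sigma>)" for \<sigma>
  have "(\<Sum>\<sigma>\<in>Sym n. (g \<sigma>)\<^sup>2) = (\<Sum>\<sigma>\<in>Sym n. (f \<sigma>)\<^sup>2)"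
    unfolding g_def by (rule sum_Sym_swap_comp[OF assms])
  moreover have "(\<Sum>\<sigma>\<in>Sym n. (f \<sigma> - g \<sigma>)\<^sup>2) =
      (\<Sum>\<sigma>\<in>Sym n. (f \<sigma>)\<^sup>2) + (\<Sum>\<sigma>\<in>Sym n. (g \<sigma>)\<^sup>2) - 2 * (\<Sum>\<sigma>\<in>Sym n. f \<sigma> * g \<sigma>)"
    by (simp add: power2_diff sum.distrib sum_subtractf mult.assoc flip: sum_distrib_left)
  moreover have "(\<Sum>\<sigma>\<in>Sym n. f \<sigma> * (f \<sigma> - g \<sigma>)) = (\<Sum>\<sigma>\<in>Sym n. (f \<sigma>)\<^sup>2) - (\<Sum>\<sigma>\<in>Sym n. f \<sigma> * g \<sigma>)"
    by (simp add: right_diff_distrib sum_subtractf power2_eq_square)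
  ultimately have "2 * (\<Sum>\<sigma>\<in>Sym n. f \<sigma> * (f \<sigma> - g \<sigma>)) = (\<Sum>\<sigma>\<in>Sym n. (f \<sigma> - g \<sigma>)\<^sup>2)"
    by simp
  then show ?thesis by (simp only: g_def)
qed

lemma sum_ic_op:
  "(\<Sum>\<sigma>\<in>Sym n. 2 * (f \<sigma> * ic_op n \<alpha> f \<sigma>)) = ic_form n \<alpha> f"
proof -
  have "(\<Sum>\<sigma>\<in>Sym n. 2 * (f \<sigma> * ic_op n \<alpha> f \<sigma>)) =
      (\<Sum>(j, i)\<in>edges n. \<alpha> i j * (2 * (\<Sum>\<sigma>\<in>Sym n. f \<sigma> * (f \<sigma> - f (swap i j \<circ> \<sigma>)))))"
    unfolding ic_op_def sum_distrib_left case_prod_unfold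
    by (subst sum.swap) (simp add: algebra_simps)
  also have "\<dots> = (\<Sum>(j, i)\<in>edges n. \<alpha> i j * (\<Sum>\<sigma>\<in>Sym n. (f \<sigma> - f (swap i j \<circ> \<sigma>))\<^sup>2))"
  proof (intro sum.cong refl, clarify)
    fix j i assume "(j, i) \<in> edges n"
    then have "i \<in> {1..n}" "j \<in> {1..n}" by (auto dest: edgesD)
    from sum_Sym_swap_parts[OF this] show
      "\<alpha> i j * (2 * (\<Sum>\<sigma>\<in>Sym n. f \<sigma> * (f \<sigma> - f (swap i j \<circ> \<sigma>)))) =
       \<alpha> i j * (\<Sum>\<sigma>\<in>Sym n. (f \<sigma> - f (swap i j \<circ> \<sigma>))\<^sup>2)"
      by (rule arg_cong)
  qed
  also have "\<dots> = ic_form n \<alpha> f"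
    unfolding ic_form_def sum_distrib_left case_prod_unfold by (rule sum.swap)
  finally show ?thesis .
qed

lemma interchange_laplacian_second_eigenvalue:
  assumes n: "2 \<le> n" and \<alpha>: "sym_weights n \<alpha>"
  defines "c \<equiv> second_smallest_eigenvalue (interchange_laplacian n \<alpha>)"
  shows "\<exists>f. (\<Sum>\<sigma>\<in>Sym n. (f \<sigma>)\<^sup>2) = 1 \<and> (\<Sum>\<sigma>\<in>Sym n. f \<sigma>) = 0 \<and>
      (\<forall>\<sigma>\<in>Sym n. ic_op n \<alpha> f \<sigma> = c * f \<sigma>)"
    and "(\<Sum>\<sigma>\<in>Sym n. f \<sigma>) = 0 \<Longrightarrow> 2 * c * (\<Sum>\<sigma>\<in>Sym n. (f \<sigma>)\<^sup>2) \<le> ic_form n \<alpha> f"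
proof -
  define a where "a \<sigma> \<sigma>' =
      (if \<sigma> = \<sigma>' then (\<Sum>m\<in>{1..n}. \<Sum>l\<in>{1..<m}. \<alpha> l m)
       else - (\<Sum>j\<in>{1..n}. \<Sum>i\<in>{1..<j}. if \<sigma>' = swap i j \<circ> \<sigma> then \<alpha> i j else 0))"
    for \<sigma> \<sigma>' :: "nat \<Rightarrow> nat"
  \<comment> \<open>Since \<open>\<sigma>\<close> attains the value i, a swap of i with j \<noteq> i
    changes it. So no swap contributes to a diagonal entry, and \<open>a\<close> gets the uniform
    formula \<open>a_alt\<close>.\<close>
  have moves: "swap i j \<circ> \<sigma> \<noteq> \<sigma>" if "(j, i) \<in> edges n" "\<sigma> \<in> Sym n" for i j \<sigma>
  proof
    assume eq: "swap i j \<circ> \<sigma> = \<sigma>"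
    have "bij \<sigma>" using that(2) permutes_bij by (auto simp: Sym_def)
    then obtain x where "\<sigma> x = i" by (metis bij_pointE)
    with fun_cong[OF eq, of x] edgesD(3)[OF that(1)] show False by simp
  qed
  have a_alt: "a \<sigma> \<sigma>' = (if \<sigma>' = \<sigma> then (\<Sum>(j, i)\<in>edges n. \<alpha> i j) else 0)
      - (\<Sum>(j, i)\<in>edges n. if \<sigma>' = swap i j \<circ> \<sigma> then \<alpha> i j else 0)"
    if "\<sigma> \<in> Sym n" for \<sigma> \<sigma>'
  proof (cases "\<sigma> = \<sigma>'")
    case True
    then have "\<sigma>' \<noteq> swap i j \<circ> \<sigma>" if "(j, i) \<in> edges n" for i j
      using moves[OF that \<open>\<sigma> \<in> Sym n\<close>] by metis
    then have "(\<Sum>(j, i)\<in>edges n. if \<sigma>' = swap i j \<circ> \<sigma> then \<alpha> i j else 0) = 0"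
      by (intro sum.neutral) auto
    with True show ?thesis by (simp add: a_def sum_edges)
  next
    case False
    then show ?thesis by (simp add: a_def sum_edges)
  qed
  have apply_a: "(\<Sum>\<sigma>'\<in>Sym n. a \<sigma> \<sigma>' * f \<sigma>') = ic_op n \<alpha> f \<sigma>" if \<sigma>: "\<sigma> \<in> Sym n" for \<sigma> f
  proof -
    have *: "(\<Sum>\<sigma>'\<in>Sym n. (if \<sigma>' = \<tau> then b else 0) * f \<sigma>') = b * f \<tau>" if "\<tau> \<in> Sym n" for \<tau> b
      using that by (simp add: if_distrib[of "\<lambda>x. x * _"] finite_Sym cong: if_cong)
    have "(\<Sum>\<sigma>'\<in>Sym n. a \<sigma> \<sigma>' * f \<sigma>') =
        (\<Sum>(j, i)\<in>edges n. \<alpha> i j) * f \<sigma> -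
        (\<Sum>\<sigma>'\<in>Sym n. \<Sum>(j, i)\<in>edges n. (if \<sigma>' = swap i j \<circ> \<sigma> then \<alpha> i j else 0) * f \<sigma>')"
      unfolding a_alt[OF \<sigma>] left_diff_distrib sum_subtractf *[OF \<sigma>] sum_distrib_right case_prod_unfold ..
    also have "(\<Sum>\<sigma>'\<in>Sym n. \<Sum>(j, i)\<in>edges n. (if \<sigma>' = swap i j \<circ> \<sigma> then \<alpha> i j else 0) * f \<sigma>') =
        (\<Sum>(j, i)\<in>edges n. \<Sum>\<sigma>'\<in>Sym n. (if \<sigma>' = swap i j \<circ> \<sigma> then \<alpha> i j else 0) * f \<sigma>')"
      unfolding case_prod_unfold by (rule sum.swap)
    also have "\<dots> = (\<Sum>(j, i)\<in>edges n. \<alpha> i j * f (swap i j \<circ> \<sigma>))"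
      by (intro sum.cong refl, clarify, rule *)
        (intro swap_comp_mem_Sym \<sigma>; auto dest: edgesD)
    finally show ?thesis
      unfolding ic_op_def sum_distrib_right case_prod_unfold sum_subtractf[symmetric]
      by (simp add: right_diff_distrib)
  qed
  have form: "2 * (\<Sum>\<sigma>\<in>Sym n. f \<sigma> * (\<Sum>\<sigma>'\<in>Sym n. a \<sigma> \<sigma>' * f \<sigma>')) = ic_form n \<alpha> f" for f
    unfolding sum_ic_op[symmetric] by (simp add: apply_a sum_distrib_left)
  have card: "2 \<le> card (Sym n)"
    using fact_mono_nat[OF n] by (simp add: Sym_def card_permutations)
  have sym: "a \<sigma> \<sigma>' = a \<sigma>' \<sigma>" if "\<sigma> \<in> Sym n" "\<sigma>' \<in> Sym n" for \<sigma> \<sigma>'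
  proof -
    have "\<sigma>' = swap i j \<circ> \<sigma> \<longleftrightarrow> \<sigma> = swap i j \<circ> \<sigma>'" for i j by auto
    then show ?thesis by (auto simp: a_def)
  qed
  have rows: "(\<Sum>\<sigma>'\<in>Sym n. a \<sigma> \<sigma>') = 0" if "\<sigma> \<in> Sym n" for \<sigma>
    using apply_a[OF that, of "\<lambda>_. 1"] by (simp add: ic_op_def case_prod_unfold)
  have psd: "0 \<le> (\<Sum>\<sigma>\<in>Sym n. f \<sigma> * (\<Sum>\<sigma>'\<in>Sym n. a \<sigma> \<sigma>' * f \<sigma>'))" for f
    using form[of f] ic_form_nonneg[OF \<alpha>, of f] by linarith
  have c: "c = second_smallest_eigenvalue (indexed_mat (Sym_list n) a)"
    unfolding c_def interchange_laplacian_def a_def ..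
  note * = second_smallest_eigenvalue_indexed_mat
    [of _ _ a, OF distinct_Sym_list set_Sym_list card _ _ psd, folded c]
  have "\<exists>f. (\<Sum>\<sigma>\<in>Sym n. (f \<sigma>)\<^sup>2) = 1 \<and> (\<Sum>\<sigma>\<in>Sym n. f \<sigma>) = 0 \<and>
      (\<forall>\<sigma>\<in>Sym n. (\<Sum>\<sigma>'\<in>Sym n. a \<sigma> \<sigma>' * f \<sigma>') = c * f \<sigma>)"
    by (rule *(1)) (fact sym rows)+
  then show "\<exists>f. (\<Sum>\<sigma>\<in>Sym n. (f \<sigma>)\<^sup>2) = 1 \<and> (\<Sum>\<sigma>\<in>Sym n. f \<sigma>) = 0 \<and>
      (\<forall>\<sigma>\<in>Sym n. ic_op n \<alpha> f \<sigma> = c * f \<sigma>)"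
    by (simp add: apply_a)
  show "2 * c * (\<Sum>\<sigma>\<in>Sym n. (f \<sigma>)\<^sup>2) \<le> ic_form n \<alpha> f" if "(\<Sum>\<sigma>\<in>Sym n. f \<sigma>) = 0"
  proof -
    have "c * (\<Sum>\<sigma>\<in>Sym n. (f \<sigma>)\<^sup>2) \<le> (\<Sum>\<sigma>\<in>Sym n. f \<sigma> * (\<Sum>\<sigma>'\<in>Sym n. a \<sigma> \<sigma>' * f \<sigma>'))"
      by (rule *(2)) (fact sym rows that)+
    then show ?thesis unfolding form[symmetric] by simp
  qed
qed

subsection \<open>Network reduction and induction\<close>

text \<open>
  Particle \<open>l\<close> alone performs the random walk, so its marginal of an eigenfunction of the interchange
  process satisfies the eigenvalue equation of the random walk.
\<close>

lemma rw_form_marginal: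
  fixes f :: "(nat \<Rightarrow> nat) \<Rightarrow> real"
  assumes l: "l \<in> {1..n}"
    and eigen: "\<And>\<sigma>. \<sigma> \<in> Sym n \<Longrightarrow> ic_op n \<alpha> f \<sigma> = c * f \<sigma>"
  defines "h \<equiv> \<lambda>x. \<Sum>\<sigma> | \<sigma> \<in> Sym n \<and> \<sigma> l = x. f \<sigma>"
  shows "rw_form n \<alpha> h = c * (\<Sum>x\<in>{1..n}. (h x)\<^sup>2)"
proof -
  have val: "\<sigma> l \<in> {1..n}" if "\<sigma> \<in> Sym n" for \<sigma>
    using that l permutes_in_image[of \<sigma> "{1..n}" l] by (simp add: Sym_def)
  have group: "(\<Sum>\<sigma>\<in>Sym n. \<phi> (\<sigma> l) * f \<sigma>) = (\<Sum>x\<in>{1..n}. \<phi> x * h x)" for \<phi>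
  proof -
    have "(\<Sum>\<sigma>\<in>Sym n. \<phi> (\<sigma> l) * f \<sigma>) =
        (\<Sum>x\<in>{1..n}. \<Sum>\<sigma> | \<sigma> \<in> Sym n \<and> \<sigma> l = x. \<phi> (\<sigma> l) * f \<sigma>)"
      by (rule sum.group[symmetric]) (use val in \<open>auto simp: finite_Sym\<close>)
    also have "\<dots> = (\<Sum>x\<in>{1..n}. \<phi> x * h x)"
      unfolding h_def sum_distrib_left by (intro sum.cong) auto
    finally show ?thesis .
  qed
  \<comment> \<open>The eigenvalue equation will be tested against \<open>h (\<sigma> l)\<close>.
    Moving the swap from \<open>f\<close> onto this test function leaves a sum against the marginal,
    in which only the positions i and j contribute.\<close>
  have edge: "(\<Sum>\<sigma>\<in>Sym n. h (\<sigma> l) * (f \<sigma> - f (swap i j \<circ> \<sigma>))) = (h i - h j)\<^sup>2"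
    if "(j, i) \<in> edges n" for i j
  proof -
    have ij: "i \<in> {1..n}" "j \<in> {1..n}" "i \<noteq> j" using edgesD[OF that] by auto
    have "(\<Sum>\<sigma>\<in>Sym n. h (\<sigma> l) * f (swap i j \<circ> \<sigma>)) = (\<Sum>\<sigma>\<in>Sym n. h (swap i j (\<sigma> l)) * f \<sigma>)"
      using sum_Sym_swap_comp[OF ij(1,2), of "\<lambda>\<sigma>. h (swap i j (\<sigma> l)) * f \<sigma>"] by simp
    then have "(\<Sum>\<sigma>\<in>Sym n. h (\<sigma> l) * (f \<sigma> - f (swap i j \<circ> \<sigma>))) =
        (\<Sum>\<sigma>\<in>Sym n. (h (\<sigma> l) - h (swap i j (\<sigma> l))) * f \<sigma>)"
      by (simp only: right_diff_distrib left_diff_distrib sum_subtractf)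
    also have "\<dots> = (\<Sum>x\<in>{1..n}. (h x - h (swap i j x)) * h x)"
      by (rule group)
    also have "\<dots> = (\<Sum>x\<in>{i, j}. (h x - h (swap i j x)) * h x)"
      using ij by (intro sum.mono_neutral_right) (auto simp: Transposition.transpose_def)
    also have "\<dots> = (h i - h j)\<^sup>2"
      using ij(3) by (simp add: power2_eq_square algebra_simps)
    finally show ?thesis .
  qed
  have "c * (\<Sum>x\<in>{1..n}. (h x)\<^sup>2) = (\<Sum>\<sigma>\<in>Sym n. h (\<sigma> l) * (c * f \<sigma>))"
    using group[of h] by (simp add: power2_eq_square mult.left_commute flip: sum_distrib_left)
  also have "\<dots> = (\<Sum>\<sigma>\<in>Sym n. h (\<sigma> l) * ic_op n \<alpha> f \<sigma>)"
    by (intro sum.cong) (simp_all add: eigen)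
  also have "\<dots> = (\<Sum>(j, i)\<in>edges n. \<alpha> i j * (\<Sum>\<sigma>\<in>Sym n. h (\<sigma> l) * (f \<sigma> - f (swap i j \<circ> \<sigma>))))"
    unfolding ic_op_def sum_distrib_left case_prod_unfold
    by (subst sum.swap) (simp add: mult.left_commute)
  also have "\<dots> = rw_form n \<alpha> h"
    unfolding rw_form_def by (intro sum.cong refl) (auto simp: edge)
  finally show ?thesis ..
qed

section \<open>Eliminating the last vertex in the random walk\<close>

text \<open>The star-mesh transform of electrical networks: for positive total weight at
  \<open>Suc n\<close>, its off-diagonal values are the weights of the Schur complement of the
  Laplacian at that vertex.\<close>

definition delete_last :: "nat \<Rightarrow> (nat \<Rightarrow> nat \<Rightarrow> real) \<Rightarrow> nat \<Rightarrow> nat \<Rightarrow> real" where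
  "delete_last n \<alpha> i j =
    \<alpha> i j + \<alpha> i (Suc n) * \<alpha> j (Suc n) / (\<Sum>l\<in>{1..n}. \<alpha> l (Suc n))"

lemma sym_weights_Suc: "sym_weights (Suc n) \<alpha> \<Longrightarrow> sym_weights n \<alpha>"
  by (auto simp: sym_weights_def)

lemma last_weight_nonneg:
  "sym_weights (Suc n) \<alpha> \<Longrightarrow> i \<in> {1..n} \<Longrightarrow> 0 \<le> \<alpha> i (Suc n)"
  by (auto simp: sym_weights_def)

lemma sym_weights_delete_last:
  assumes "sym_weights (Suc n) \<alpha>"
  shows "sym_weights n (delete_last n \<alpha>)"
  unfolding sym_weights_def delete_last_def
  using sym_weightsD[OF sym_weights_Suc[OF assms]] last_weight_nonneg[OF assms]
  by (auto simp: mult.commute intro!: add_nonneg_nonneg divide_nonneg_nonneg mult_nonneg_nonneg sum_nonneg)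

text \<open>
  Eliminating the hub \<open>t\<close> of a star by putting it at the weighted mean of its neighbours. For
  \<open>s = 0\<close> all weights vanish, so that \<open>x / 0 = 0\<close> is harmless.
\<close>

lemma star_mesh_identity:
  fixes a h :: "nat \<Rightarrow> real"
  assumes nonneg: "\<And>i. i \<in> {1..n} \<Longrightarrow> 0 \<le> a i"
  defines "s \<equiv> \<Sum>i\<in>{1..n}. a i"
  defines "t \<equiv> (\<Sum>i\<in>{1..n}. a i * h i) / s"
  shows "(\<Sum>i\<in>{1..n}. a i * (h i - t)\<^sup>2) = (\<Sum>(j, i)\<in>edges n. a i * a j / s * (h i - h j)\<^sup>2)"
proof (cases "s = 0")
  case True
  then have "a i = 0" if "i \<in> {1..n}" for i
    using sum_nonneg_0[of "{1..n}" a i] nonneg that unfolding s_def by blast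
  with True show ?thesis by simp
next
  case False
  define m where "m = (\<Sum>i\<in>{1..n}. a i * h i)"
  define q where "q = (\<Sum>i\<in>{1..n}. a i * (h i)\<^sup>2)"
  have "(\<Sum>i\<in>{1..n}. a i * (h i - t)\<^sup>2) =
      (\<Sum>i\<in>{1..n}. a i * (h i)\<^sup>2 - 2 * t * (a i * h i) + t\<^sup>2 * a i)"
    by (intro sum.cong) (simp_all add: power2_eq_square algebra_simps)
  also have "\<dots> = q - 2 * t * m + t\<^sup>2 * s"
    unfolding sum.distrib sum_subtractf sum_distrib_left[symmetric] q_def m_def s_def ..
  also have "\<dots> = q - m\<^sup>2 / s"
    using False unfolding t_def m_def[symmetric] by (simp add: field_simps power2_eq_square)
  finally have lhs: "(\<Sum>i\<in>{1..n}. a i * (h i - t)\<^sup>2) = q - m\<^sup>2 / s" .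
  \<comment> \<open>Over all ordered pairs, where the diagonal adds nothing, the double sum factors
    into the moments \<open>s\<close>, \<open>m\<close> and \<open>q\<close>.\<close>
  have "2 * (\<Sum>(j, i)\<in>edges n. a i * a j / s * (h i - h j)\<^sup>2) =
      (\<Sum>x\<in>{1..n}. \<Sum>y\<in>{1..n}. a x * a y / s * (h x - h y)\<^sup>2)"
    by (rule sum_edges_symmetric[symmetric]) (simp_all add: mult.commute power2_commute)
  also have "\<dots> = (\<Sum>x\<in>{1..n}. \<Sum>y\<in>{1..n}.
      (a x * (h x)\<^sup>2 * a y + a x * (a y * (h y)\<^sup>2) - 2 * (a x * h x) * (a y * h y)) / s)"
    by (intro sum.cong refl) (simp add: power2_eq_square algebra_simps add_divide_distrib diff_divide_distrib)
  also have "\<dots> = (\<Sum>x\<in>{1..n}. (a x * (h x)\<^sup>2 * s + a x * q - 2 * (a x * h x) * m) / s)"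
    by (intro sum.cong refl)
      (simp only: sum_divide_distrib[symmetric] sum.distrib sum_subtractf
        sum_distrib_left[symmetric] s_def q_def m_def)
  also have "\<dots> = (q * s + s * q - 2 * m * m) / s"
    unfolding sum_divide_distrib[symmetric] sum.distrib sum_subtractf
      sum_distrib_right[symmetric] sum_distrib_left[symmetric]
    by (simp add: q_def m_def s_def)
  also have "\<dots> = 2 * (q - m\<^sup>2 / s)"
    using False by (simp add: field_simps power2_eq_square)
  finally show ?thesis using lhs by simp
qed

text \<open>Giving the last vertex the weighted mean \<open>t\<close> of its neighbours turns the
  energy of its edges into the energy of the new weights. Subtracting the mean leaves the form
  unchanged, and since \<open>h\<close> has mean zero the cross term vanishes, so the squared norm
  can only have grown.\<close>

lemma rw_gap_delete_last:
  assumes \<alpha>: "sym_weights (Suc n) \<alpha>" and c: "0 \<le> c"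
    and gap: "\<And>h. (\<Sum>x\<in>{1..Suc n}. h x) = 0 \<Longrightarrow>
      c * (\<Sum>x\<in>{1..Suc n}. (h x)\<^sup>2) \<le> rw_form (Suc n) \<alpha> h"
    and h: "(\<Sum>x\<in>{1..n}. h x) = 0"
  shows "c * (\<Sum>x\<in>{1..n}. (h x)\<^sup>2) \<le> rw_form n (delete_last n \<alpha>) h"
proof -
  let ?a = "\<lambda>i. \<alpha> i (Suc n)"
  define t where "t = (\<Sum>i\<in>{1..n}. ?a i * h i) / (\<Sum>i\<in>{1..n}. ?a i)"
  \<comment> \<open>This is the mean of the extended function, whose values on {1..n} sum to
    0.\<close>
  define u where "u = t / real (Suc n)"
  define g where "g x = (if x = Suc n then t else h x) - u" for x
  have split_sum: "(\<Sum>x\<in>{1..Suc n}. F (g x)) = (\<Sum>x\<in>{1..n}. F (h x - u)) + F (t - u)" for F :: "real \<Rightarrow> real"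
    by (simp add: g_def)
  have "(\<Sum>x\<in>{1..Suc n}. g x) = 0"
    unfolding split_sum[of "\<lambda>x. x"] sum_subtractf h by (simp add: u_def field_simps)
  then have "c * (\<Sum>x\<in>{1..Suc n}. (g x)\<^sup>2) \<le> rw_form (Suc n) \<alpha> g"
    by (rule gap)
  also have "rw_form (Suc n) \<alpha> g = rw_form n \<alpha> h + (\<Sum>i\<in>{1..n}. ?a i * (h i - t)\<^sup>2)"
  proof -
    have "(\<Sum>(j, i)\<in>edges n. \<alpha> i j * (g i - g j)\<^sup>2) = rw_form n \<alpha> h"
      unfolding rw_form_def
    proof (intro sum.cong refl, clarify)
      fix j i assume "(j, i) \<in> edges n"
      then have "i \<noteq> Suc n" "j \<noteq> Suc n" by (auto simp: edges_def)
      then show "\<alpha> i j * (g i - g j)\<^sup>2 = \<alpha> i j * (h i - h j)\<^sup>2" by (simp add: g_def)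
    qed
    then show ?thesis
      unfolding rw_form_def sum_edges_Suc[of "\<lambda>i j. \<alpha> i j * (g i - g j)\<^sup>2"] by (simp add: g_def)
  qed
  also have "\<dots> = rw_form n (delete_last n \<alpha>) h"
    unfolding t_def
    by (subst star_mesh_identity)
      (simp_all add: last_weight_nonneg[OF \<alpha>] rw_form_def delete_last_def
        distrib_right case_prod_unfold flip: sum.distrib)
  finally have "c * (\<Sum>x\<in>{1..Suc n}. (g x)\<^sup>2) \<le> rw_form n (delete_last n \<alpha>) h" .
  moreover have "(\<Sum>x\<in>{1..n}. (h x)\<^sup>2) \<le> (\<Sum>x\<in>{1..Suc n}. (g x)\<^sup>2)"
  proof -
    have "(\<Sum>x\<in>{1..n}. (h x - u)\<^sup>2) = (\<Sum>x\<in>{1..n}. (h x)\<^sup>2 - 2 * u * h x + u\<^sup>2)"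
      by (intro sum.cong) (simp_all add: power2_eq_square algebra_simps)
    also have "\<dots> = (\<Sum>x\<in>{1..n}. (h x)\<^sup>2) + real n * u\<^sup>2"
      unfolding sum.distrib sum_subtractf sum_distrib_left[symmetric] h by simp
    finally show ?thesis
      unfolding split_sum[of "\<lambda>x. x\<^sup>2"] by simp
  qed
  ultimately show ?thesis
    using mult_left_mono[OF _ c] by (meson order_trans)
qed

section \<open>Cosets of the stabilizer of the last vertex and the octopus inequality\<close>

text \<open>The index l is the particle at vertex \<open>Suc n\<close>: composing
  \<open>\<sigma>\<close> with \<open>swap l (Suc n)\<close> on the right gives a permutation that
  fixes \<open>Suc n\<close>. For l = \<open>Suc n\<close> the swap is the identity.\<close>

lemma bij_betw_Sym_Suc:
  "bij_betw (\<lambda>(l, \<tau>). \<tau> \<circ> swap l (Suc n)) ({1..Suc n} \<times> Sym n) (Sym (Suc n))"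
  unfolding bij_betw_def
proof
  let ?N = "Suc n"
  have fix_last: "\<tau> ?N = ?N" if "\<tau> \<in> Sym n" for \<tau>
    using that permutes_not_in[of \<tau> "{1..n}" ?N] by (simp add: Sym_def)
  have mem: "\<tau> \<in> Sym ?N" if "\<tau> \<in> Sym n" for \<tau>
    using that permutes_subset[of \<tau> "{1..n}" "{1..?N}"] by (simp add: Sym_def)
  show "inj_on (\<lambda>(l, \<tau>). \<tau> \<circ> swap l ?N) ({1..?N} \<times> Sym n)"
  proof (rule inj_onI, clarify)
    fix l \<tau> l' \<tau>'
    assume \<tau>: "\<tau> \<in> Sym n" "\<tau>' \<in> Sym n" and eq: "\<tau> \<circ> swap l ?N = \<tau>' \<circ> swap l' ?N"
    have "inj \<tau>'" using \<tau>(2) permutes_inj by (auto simp: Sym_def)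
    from fun_cong[OF eq, of l] have "\<tau>' ?N = \<tau>' (swap l' ?N l)"
      by (simp add: fix_last[OF \<tau>(1)] fix_last[OF \<tau>(2)])
    with \<open>inj \<tau>'\<close> have "?N = swap l' ?N l" by (simp add: inj_eq)
    then have "l = l'" by (metis transpose_apply_second transpose_involutory)
    moreover have "\<tau> \<circ> swap l ?N \<circ> swap l ?N = \<tau>' \<circ> swap l' ?N \<circ> swap l ?N"
      by (simp only: eq)
    ultimately show "l = l' \<and> \<tau> = \<tau>'"
      by (simp add: comp_assoc)
  qed
  show "(\<lambda>(l, \<tau>). \<tau> \<circ> swap l ?N) ` ({1..?N} \<times> Sym n) = Sym ?N"
  proof (intro subset_antisym subsetI)
    fix \<sigma> assume "\<sigma> \<in> (\<lambda>(l, \<tau>). \<tau> \<circ> swap l ?N) ` ({1..?N} \<times> Sym n)"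
    then obtain l \<tau> where "l \<in> {1..?N}" "\<tau> \<in> Sym n" "\<sigma> = \<tau> \<circ> swap l ?N" by auto
    then show "\<sigma> \<in> Sym ?N"
      using swap_comp_mem_Sym(2)[of l ?N ?N \<tau>] mem[of \<tau>] by simp
  next
    fix \<sigma> assume \<sigma>: "\<sigma> \<in> Sym ?N"
    then have perm: "\<sigma> permutes {1..?N}" by (simp add: Sym_def)
    then have "?N \<in> \<sigma> ` {1..?N}" by (simp add: permutes_image)
    then obtain l where l: "l \<in> {1..?N}" "\<sigma> l = ?N" by (metis imageE)
    have "\<sigma> \<circ> swap l ?N permutes {1..?N}"
      using swap_comp_mem_Sym(2)[OF l(1) _ \<sigma>, of ?N] by (simp add: Sym_def)
    then have "\<sigma> \<circ> swap l ?N permutes {1..n}"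
    proof (rule permutes_superset)
      fix x assume "x \<in> {1..?N} - {1..n}"
      then have "x = ?N" by auto
      then show "(\<sigma> \<circ> swap l ?N) x = x" using l(2) by simp
    qed
    moreover have "\<sigma> = \<sigma> \<circ> swap l ?N \<circ> swap l ?N" by (simp add: comp_assoc)
    ultimately show "\<sigma> \<in> (\<lambda>(l, \<tau>). \<tau> \<circ> swap l ?N) ` ({1..?N} \<times> Sym n)"
      using l(1) by (intro image_eqI[of _ _ "(l, \<sigma> \<circ> swap l ?N)"]) (auto simp: Sym_def)
  qed
qed

lemma sum_Sym_Suc:
  "(\<Sum>\<sigma>\<in>Sym (Suc n). F \<sigma>) = (\<Sum>l\<in>{1..Suc n}. \<Sum>\<tau>\<in>Sym n. F (\<tau> \<circ> swap l (Suc n)))"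
  by (simp add: sum.cartesian_product case_prod_unfold
      flip: sum.reindex_bij_betw[OF bij_betw_Sym_Suc[of n], of F])

lemma sum_Sym_last:
  fixes F :: "(nat \<Rightarrow> nat) \<Rightarrow> real"
  assumes l: "l \<in> {1..Suc n}"
  shows "(\<Sum>\<sigma> | \<sigma> \<in> Sym (Suc n) \<and> \<sigma> l = Suc n. F \<sigma>) = (\<Sum>\<tau>\<in>Sym n. F (\<tau> \<circ> swap l (Suc n)))"
proof -
  let ?N = "Suc n"
  have val: "(\<tau> \<circ> swap k ?N) l = ?N \<longleftrightarrow> k = l" if "\<tau> \<in> Sym n" for \<tau> k
  proof -
    have perm: "\<tau> permutes {1..n}" using that by (simp add: Sym_def)
    then have "\<tau> ?N = ?N" by (rule permutes_not_in) simp
    then have "\<tau> x = ?N \<longleftrightarrow> x = ?N" for x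
      using permutes_inj[OF perm] by (metis injD)
    then show ?thesis
      by (simp add: Transposition.transpose_def)
  qed
  have "(\<Sum>\<sigma> | \<sigma> \<in> Sym ?N \<and> \<sigma> l = ?N. F \<sigma>) = (\<Sum>\<sigma>\<in>Sym ?N. if \<sigma> l = ?N then F \<sigma> else 0)"
    by (simp add: sum.If_cases[OF finite_Sym] Int_def)
  also have "\<dots> = (\<Sum>k\<in>{1..?N}. \<Sum>\<tau>\<in>Sym n. if k = l then F (\<tau> \<circ> swap k ?N) else 0)"
    unfolding sum_Sym_Suc by (intro sum.cong refl) (simp only: val)
  also have "\<dots> = (\<Sum>k\<in>{1..?N}. if k = l then (\<Sum>\<tau>\<in>Sym n. F (\<tau> \<circ> swap k ?N)) else 0)"
    by (intro sum.cong) auto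
  also have "\<dots> = (\<Sum>\<tau>\<in>Sym n. F (\<tau> \<circ> swap l ?N))"
    using l by simp
  finally show ?thesis .
qed

definition octopus_inequality :: "nat \<Rightarrow> bool" where
  "octopus_inequality k \<longleftrightarrow> (\<forall>(g :: (nat \<Rightarrow> nat) \<Rightarrow> real) (\<gamma> :: nat \<Rightarrow> real).
    (\<forall>i\<in>{1..k - 1}. 0 \<le> \<gamma> i) \<longrightarrow>
    (\<Sum>\<sigma>\<in>Sym k. \<Sum>i\<in>{1..k - 1}. \<gamma> i * (g \<sigma> - g (swap i k \<circ> \<sigma>))\<^sup>2)
      \<ge> (\<Sum>\<sigma>\<in>Sym k. \<Sum>j\<in>{1..k - 1}. \<Sum>i\<in>{1..<j}.
            \<gamma> i * \<gamma> j / (\<Sum>l\<in>{1..k - 1}. \<gamma> l) * (g \<sigma> - g (swap i j \<circ> \<sigma>))\<^sup>2))"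

text \<open>Swaps of vertices act on the left and the coset representatives on the right, so the
  forms on the cosets add up to one sum over \<open>Sym (Suc n)\<close> with edges inside {1..n}.
  The octopus inequality with \<gamma> i = \<open>\<alpha> i (Suc n)\<close> bounds the part from
  the new weights by the part from the edges at \<open>Suc n\<close>.\<close>

lemma ic_form_delete_last:
  assumes octopus: "octopus_inequality (Suc n)" and \<alpha>: "sym_weights (Suc n) \<alpha>"
  shows "(\<Sum>l\<in>{1..Suc n}. ic_form n (delete_last n \<alpha>) (\<lambda>\<tau>. f (\<tau> \<circ> swap l (Suc n))))
    \<le> ic_form (Suc n) \<alpha> f"
proof -
  let ?N = "Suc n"
  let ?d = "\<lambda>\<sigma> i j. (f \<sigma> - f (swap i j \<circ> \<sigma>))\<^sup>2"
  have "(\<Sum>l\<in>{1..?N}. ic_form n (delete_last n \<alpha>) (\<lambda>\<tau>. f (\<tau> \<circ> swap l ?N))) =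
      (\<Sum>\<sigma>\<in>Sym ?N. \<Sum>(j, i)\<in>edges n. delete_last n \<alpha> i j * ?d \<sigma> i j)"
    unfolding ic_form_def sum_Sym_Suc by (simp only: comp_assoc)
  also have "\<dots> = (\<Sum>\<sigma>\<in>Sym ?N. \<Sum>(j, i)\<in>edges n. \<alpha> i j * ?d \<sigma> i j) +
      (\<Sum>\<sigma>\<in>Sym ?N. \<Sum>(j, i)\<in>edges n.
        \<alpha> i ?N * \<alpha> j ?N / (\<Sum>l\<in>{1..n}. \<alpha> l ?N) * ?d \<sigma> i j)"
    by (simp add: delete_last_def distrib_right case_prod_unfold sum.distrib)
  also have "\<dots> \<le> (\<Sum>\<sigma>\<in>Sym ?N. \<Sum>(j, i)\<in>edges n. \<alpha> i j * ?d \<sigma> i j) +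
      (\<Sum>\<sigma>\<in>Sym ?N. \<Sum>i\<in>{1..n}. \<alpha> i ?N * ?d \<sigma> i ?N)"
    using octopus[unfolded octopus_inequality_def, rule_format, of "\<lambda>i. \<alpha> i ?N" f]
      last_weight_nonneg[OF \<alpha>]
    unfolding sum_edges by simp
  also have "\<dots> = ic_form ?N \<alpha> f"
    unfolding ic_form_def sum_edges_Suc sum.distrib ..
  finally show ?thesis .
qed

section \<open>Induction on the number of vertices\<close>

text \<open>Stating the induction with a constant \<open>c\<close> allows it to start at n = 1,
  where there is no second eigenvalue and a mean-zero function on the single permutation is zero.
  The weights and \<open>f\<close> vary, \<open>c\<close> does not.\<close>

lemma ic_gap_of_rw_gap:
  assumes octopus: "\<And>k. 2 \<le> k \<Longrightarrow> octopus_inequality k" and c: "0 \<le> c"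
    and n: "1 \<le> n" and \<alpha>: "sym_weights n \<alpha>"
    and gap: "\<And>h. (\<Sum>x\<in>{1..n}. h x) = 0 \<Longrightarrow> c * (\<Sum>x\<in>{1..n}. (h x)\<^sup>2) \<le> rw_form n \<alpha> h"
    and f: "(\<Sum>\<sigma>\<in>Sym n. f \<sigma>) = 0"
  shows "2 * c * (\<Sum>\<sigma>\<in>Sym n. (f \<sigma>)\<^sup>2) \<le> ic_form n \<alpha> f"
  using n \<alpha> gap f
proof (induction n arbitrary: \<alpha> f rule: nat_induct_at_least)
  case base
  have "Sym 1 = {id}" by (simp add: Sym_def)
  then have "(\<Sum>\<sigma>\<in>Sym 1. (f \<sigma>)\<^sup>2) = (\<Sum>\<sigma>\<in>Sym 1. f \<sigma>)\<^sup>2"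
    by (simp only:) simp
  also have "\<dots> = 0" unfolding base(3) by simp
  finally have "(\<Sum>\<sigma>\<in>Sym 1. (f \<sigma>)\<^sup>2) = 0" .
  with ic_form_nonneg[OF base(1)] show ?case by simp
next
  case (Suc n)
  let ?N = "Suc n"
  have N: "2 \<le> ?N" using Suc.hyps by simp
  define \<mu> where "\<mu> = second_smallest_eigenvalue (interchange_laplacian ?N \<alpha>)"
  note ic = interchange_laplacian_second_eigenvalue[OF N Suc.prems(1), folded \<mu>_def]
  obtain g where g: "(\<Sum>\<sigma>\<in>Sym ?N. (g \<sigma>)\<^sup>2) = 1" "(\<Sum>\<sigma>\<in>Sym ?N. g \<sigma>) = 0"
      "\<And>\<sigma>. \<sigma> \<in> Sym ?N \<Longrightarrow> ic_op ?N \<alpha> g \<sigma> = \<mu> * g \<sigma>"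
    using ic(1) by (elim exE conjE) blast
  have reduced_gap: "c * (\<Sum>x\<in>{1..n}. (h x)\<^sup>2) \<le> rw_form n (delete_last n \<alpha>) h"
    if "(\<Sum>x\<in>{1..n}. h x) = 0" for h
    by (rule rw_gap_delete_last[OF Suc.prems(1) c Suc.prems(2) that])
  have "c \<le> \<mu>"
  \<comment> \<open>These sums are the values of the marginals at vertex \<open>Suc n\<close>.
    Testing this one vertex suffices: a nonzero value makes the marginal a nonzero test function,
    and if all vanish, the induction hypothesis applies on every coset.\<close>
  proof (cases "\<exists>l\<in>{1..?N}. (\<Sum>\<tau>\<in>Sym n. g (\<tau> \<circ> swap l ?N)) \<noteq> 0")
    case True
    then obtain l where l: "l \<in> {1..?N}" "(\<Sum>\<tau>\<in>Sym n. g (\<tau> \<circ> swap l ?N)) \<noteq> 0" by blast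
    define h where "h x = (\<Sum>\<sigma> | \<sigma> \<in> Sym ?N \<and> \<sigma> l = x. g \<sigma>)" for x
    have form: "rw_form ?N \<alpha> h = \<mu> * (\<Sum>x\<in>{1..?N}. (h x)\<^sup>2)"
      using rw_form_marginal[OF l(1) g(3)] unfolding h_def .
    have val: "\<sigma> l \<in> {1..?N}" if "\<sigma> \<in> Sym ?N" for \<sigma>
      using that l(1) permutes_in_image[of \<sigma> "{1..?N}" l] by (simp add: Sym_def)
    have "(\<Sum>x\<in>{1..?N}. h x) = (\<Sum>\<sigma>\<in>Sym ?N. g \<sigma>)"
      unfolding h_def by (rule sum.group) (use val in \<open>auto simp: finite_Sym\<close>)
    then have "c * (\<Sum>x\<in>{1..?N}. (h x)\<^sup>2) \<le> \<mu> * (\<Sum>x\<in>{1..?N}. (h x)\<^sup>2)"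
      using Suc.prems(2)[of h] g(2) form by simp
    moreover have "h ?N \<noteq> 0"
      unfolding h_def sum_Sym_last[OF l(1)] by (rule l(2))
    then have "0 < (\<Sum>x\<in>{1..?N}. (h x)\<^sup>2)"
      by (intro sum_pos2[of _ ?N]) auto
    ultimately show ?thesis by simp
  next
    case False
    have "2 * c = 2 * c * (\<Sum>\<sigma>\<in>Sym ?N. (g \<sigma>)\<^sup>2)" using g(1) by simp
    also have "\<dots> = (\<Sum>l\<in>{1..?N}. 2 * c * (\<Sum>\<tau>\<in>Sym n. (g (\<tau> \<circ> swap l ?N))\<^sup>2))"
      unfolding sum_Sym_Suc sum_distrib_left ..
    also have "\<dots> \<le> (\<Sum>l\<in>{1..?N}. ic_form n (delete_last n \<alpha>) (\<lambda>\<tau>. g (\<tau> \<circ> swap l ?N)))"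
    proof (rule sum_mono)
      fix l assume "l \<in> {1..?N}"
      with False have zero: "(\<Sum>\<tau>\<in>Sym n. g (\<tau> \<circ> swap l ?N)) = 0" by blast
      show "2 * c * (\<Sum>\<tau>\<in>Sym n. (g (\<tau> \<circ> swap l ?N))\<^sup>2)
          \<le> ic_form n (delete_last n \<alpha>) (\<lambda>\<tau>. g (\<tau> \<circ> swap l ?N))"
        by (rule Suc.IH[OF sym_weights_delete_last[OF Suc.prems(1)] reduced_gap zero])
    qed
    also have "\<dots> \<le> ic_form ?N \<alpha> g"
      by (rule ic_form_delete_last[OF octopus[OF N] Suc.prems(1)])
    also have "\<dots> = 2 * \<mu> * (\<Sum>\<sigma>\<in>Sym ?N. (g \<sigma>)\<^sup>2)"
      unfolding sum_ic_op[symmetric] using g(3)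
      by (simp add: sum_distrib_left power2_eq_square mult_ac)
    finally show ?thesis using g(1) by simp
  qed
  \<comment> \<open>\<open>\<mu>\<close> bounds the form of every mean-zero function, so comparing
    \<open>c\<close> with the eigenvalue of \<open>g\<close> alone settles all
    \<open>f\<close>.\<close>
  then have "2 * c * (\<Sum>\<sigma>\<in>Sym ?N. (f \<sigma>)\<^sup>2) \<le> 2 * \<mu> * (\<Sum>\<sigma>\<in>Sym ?N. (f \<sigma>)\<^sup>2)"
    by (intro mult_right_mono) (auto intro: sum_nonneg)
  also have "\<dots> \<le> ic_form ?N \<alpha> f"
    using ic(2)[OF Suc.prems(3)] .
  finally show ?case .
qed

section \<open>Functions of the position of one particle\<close>

text \<open>Left multiplication by \<open>swap 1 x\<close> matches the permutations with \<sigma> 1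
  = x and those with \<sigma> 1 = 1, so every position of particle 1 is equally frequent.\<close>

lemma sum_Sym_first:
  fixes F :: "nat \<Rightarrow> real"
  assumes n: "1 \<le> n"
  shows "(\<Sum>\<sigma>\<in>Sym n. F (\<sigma> 1)) = real (card {\<sigma> \<in> Sym n. \<sigma> 1 = 1}) * (\<Sum>x\<in>{1..n}. F x)"
proof -
  have card: "card {\<sigma> \<in> Sym n. \<sigma> 1 = x} = card {\<sigma> \<in> Sym n. \<sigma> 1 = 1}" if x: "x \<in> {1..n}" for x
  proof (rule bij_betw_same_card)
    have fwd: "swap 1 x \<circ> \<sigma> \<in> {\<sigma> \<in> Sym n. \<sigma> 1 = 1}" if "\<sigma> \<in> {\<sigma> \<in> Sym n. \<sigma> 1 = x}" for \<sigma>
      using that n x swap_comp_mem_Sym(1)[of 1 n x \<sigma>] by simp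
    have bwd: "swap 1 x \<circ> \<sigma> \<in> {\<sigma> \<in> Sym n. \<sigma> 1 = x}" if "\<sigma> \<in> {\<sigma> \<in> Sym n. \<sigma> 1 = 1}" for \<sigma>
      using that n x swap_comp_mem_Sym(1)[of 1 n x \<sigma>] by simp
    show "bij_betw (\<lambda>\<sigma>. swap 1 x \<circ> \<sigma>) {\<sigma> \<in> Sym n. \<sigma> 1 = x} {\<sigma> \<in> Sym n. \<sigma> 1 = 1}"
      using fwd bwd
      by (intro bij_betw_byWitness[where f' = "\<lambda>\<sigma>. swap 1 x \<circ> \<sigma>"] ballI swap_comp_swap_comp) blast+
  qed
  have val: "\<sigma> 1 \<in> {1..n}" if "\<sigma> \<in> Sym n" for \<sigma>
    using that n permutes_in_image[of \<sigma> "{1..n}" 1] unfolding Sym_def by simp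
  have "(\<Sum>\<sigma>\<in>Sym n. F (\<sigma> 1)) = (\<Sum>x\<in>{1..n}. \<Sum>\<sigma> | \<sigma> \<in> Sym n \<and> \<sigma> 1 = x. F (\<sigma> 1))"
    by (rule sum.group[symmetric]) (use val in \<open>auto simp: finite_Sym\<close>)
  also have "\<dots> = (\<Sum>x\<in>{1..n}. real (card {\<sigma> \<in> Sym n. \<sigma> 1 = x}) * F x)"
    by (intro sum.cong) auto
  also have "\<dots> = (\<Sum>x\<in>{1..n}. real (card {\<sigma> \<in> Sym n. \<sigma> 1 = 1}) * F x)"
    by (intro sum.cong refl) (simp only: card)
  finally show ?thesis by (simp add: sum_distrib_left)
qed

text \<open>A swap of i and j is noticed by particle 1 from either end, which gives the factor 2. It
  matches the doubling in \<open>ic_form\<close>, so nothing is lost when the two second eigenvalues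
  are compared.\<close>

lemma ic_form_first:
  assumes n: "1 \<le> n"
  shows "ic_form n \<alpha> (\<lambda>\<sigma>. h (\<sigma> 1)) = 2 * real (card {\<sigma> \<in> Sym n. \<sigma> 1 = 1}) * rw_form n \<alpha> h"
proof -
  let ?K = "real (card {\<sigma> \<in> Sym n. \<sigma> 1 = 1})"
  have edge: "(\<Sum>\<sigma>\<in>Sym n. (h (\<sigma> 1) - h ((swap i j \<circ> \<sigma>) 1))\<^sup>2) = 2 * ?K * (h i - h j)\<^sup>2"
    if "(j, i) \<in> edges n" for i j
  proof -
    have ij: "i \<in> {1..n}" "j \<in> {1..n}" "i \<noteq> j" using edgesD[OF that] by auto
    have "(\<Sum>\<sigma>\<in>Sym n. (h (\<sigma> 1) - h ((swap i j \<circ> \<sigma>) 1))\<^sup>2) =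
        ?K * (\<Sum>x\<in>{1..n}. (h x - h (swap i j x))\<^sup>2)"
      using sum_Sym_first[OF n, of "\<lambda>x. (h x - h (swap i j x))\<^sup>2"] by simp
    also have "(\<Sum>x\<in>{1..n}. (h x - h (swap i j x))\<^sup>2) = (\<Sum>x\<in>{i, j}. (h x - h (swap i j x))\<^sup>2)"
      using ij by (intro sum.mono_neutral_right) (auto simp: Transposition.transpose_def)
    also have "\<dots> = 2 * (h i - h j)\<^sup>2"
      using ij(3) by (simp add: power2_commute)
    finally show ?thesis by simp
  qed
  have "ic_form n \<alpha> (\<lambda>\<sigma>. h (\<sigma> 1)) =
      (\<Sum>(j, i)\<in>edges n. \<alpha> i j * (\<Sum>\<sigma>\<in>Sym n. (h (\<sigma> 1) - h ((swap i j \<circ> \<sigma>) 1))\<^sup>2))"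
    unfolding ic_form_def sum_distrib_left case_prod_unfold by (rule sum.swap)
  also have "\<dots> = (\<Sum>(j, i)\<in>edges n. 2 * ?K * (\<alpha> i j * (h i - h j)\<^sup>2))"
    by (intro sum.cong refl, clarify) (simp only: edge mult.left_commute mult.assoc)
  also have "\<dots> = 2 * ?K * rw_form n \<alpha> h"
    by (simp add: rw_form_def sum_distrib_left case_prod_unfold)
  finally show ?thesis .
qed

theorem mainTheorem2:
  fixes n :: nat and \<alpha> :: "nat \<Rightarrow> nat \<Rightarrow> real"
  assumes octopus:
    "\<And>(k::nat) (g :: (nat \<Rightarrow> nat) \<Rightarrow> real) (\<gamma> :: nat \<Rightarrow> real).
      2 \<le> k \<Longrightarrow> (\<And>i. i \<in> {1..k - 1} \<Longrightarrow> 0 \<le> \<gamma> i) \<Longrightarrow>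
      (\<Sum>\<sigma>\<in>Sym k. \<Sum>i\<in>{1..k - 1}. \<gamma> i * (g \<sigma> - g (swap i k \<circ> \<sigma>))\<^sup>2)
      \<ge> (\<Sum>\<sigma>\<in>Sym k. \<Sum>j\<in>{1..k - 1}. \<Sum>i\<in>{1..<j}.
            \<gamma> i * \<gamma> j / (\<Sum>l\<in>{1..k - 1}. \<gamma> l) * (g \<sigma> - g (swap i j \<circ> \<sigma>))\<^sup>2)"
    and n: "2 \<le> n"
    and sym: "\<And>i j. i \<in> {1..n} \<Longrightarrow> j \<in> {1..n} \<Longrightarrow> i \<noteq> j \<Longrightarrow> \<alpha> i j = \<alpha> j i"
    and nonneg: "\<And>i j. i \<in> {1..n} \<Longrightarrow> j \<in> {1..n} \<Longrightarrow> i \<noteq> j \<Longrightarrow> 0 \<le> \<alpha> i j"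
  shows "second_smallest_eigenvalue (interchange_laplacian n \<alpha>) =
         second_smallest_eigenvalue (rw_laplacian n \<alpha>)"
proof (rule antisym)
  define c where "c = second_smallest_eigenvalue (rw_laplacian n \<alpha>)"
  define d where "d = second_smallest_eigenvalue (interchange_laplacian n \<alpha>)"
  have \<alpha>: "sym_weights n \<alpha>"
    using sym nonneg by (auto simp: sym_weights_def)
  have oct: "octopus_inequality k" if "2 \<le> k" for k
    unfolding octopus_inequality_def using octopus[OF that] by blast
  note rw = rw_laplacian_second_eigenvalue[OF n \<alpha>, folded c_def]
  note ic = interchange_laplacian_second_eigenvalue[OF n \<alpha>, folded d_def]
  obtain h where h: "(\<Sum>x\<in>{1..n}. (h x)\<^sup>2) = 1" "(\<Sum>x\<in>{1..n}. h x) = 0" "rw_form n \<alpha> h = c"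
    using rw(1) by (elim exE conjE)
  have "c \<ge> 0" using rw_form_nonneg[OF \<alpha>, of h] h(3) by simp
  obtain f where f: "(\<Sum>\<sigma>\<in>Sym n. (f \<sigma>)\<^sup>2) = 1" "(\<Sum>\<sigma>\<in>Sym n. f \<sigma>) = 0"
      "\<And>\<sigma>. \<sigma> \<in> Sym n \<Longrightarrow> ic_op n \<alpha> f \<sigma> = d * f \<sigma>"
    using ic(1) by (elim exE conjE) blast
  have "2 * c * (\<Sum>\<sigma>\<in>Sym n. (f \<sigma>)\<^sup>2) \<le> ic_form n \<alpha> f"
    using n by (intro ic_gap_of_rw_gap oct \<open>c \<ge> 0\<close> \<alpha> rw(2) f(2)) auto
  also have "\<dots> = 2 * d * (\<Sum>\<sigma>\<in>Sym n. (f \<sigma>)\<^sup>2)"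
    unfolding sum_ic_op[symmetric] using f(3)
    by (simp add: sum_distrib_left power2_eq_square mult_ac)
  finally show "c \<le> d" using f(1) by simp
  let ?K = "real (card {\<sigma> \<in> Sym n. \<sigma> 1 = 1})"
  have n1: "1 \<le> n" using n by simp
  \<comment> \<open>The identity makes \<open>?K\<close> positive, so that it can be cancelled in
    the final comparison.\<close>
  have "id \<in> {\<sigma> \<in> Sym n. \<sigma> 1 = 1}" by (simp add: Sym_def permutes_id)
  then have "?K > 0"
    using finite_Sym[of n] by (auto simp: card_gt_0_iff)
  have "(\<Sum>\<sigma>\<in>Sym n. h (\<sigma> 1)) = 0"
    using sum_Sym_first[OF n1, of h] h(2) by simp
  then have "2 * d * (\<Sum>\<sigma>\<in>Sym n. (h (\<sigma> 1))\<^sup>2) \<le> ic_form n \<alpha> (\<lambda>\<sigma>. h (\<sigma> 1))"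
    by (rule ic(2))
  then show "d \<le> c"
    unfolding sum_Sym_first[OF n1, of "\<lambda>x. (h x)\<^sup>2"] ic_form_first[OF n1] h(1,3)
    using \<open>?K > 0\<close> by simp
qed

end
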